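(* Let $A$ be a Nakayama algebra over a field $k$, let $C_A$ be its Cartan matrix, and let $p$ and $w$ be the periodicity and the weight of its resolution quiver $R_A$. Then $C_A$ has magnitude in $\mathbb{Q}$ (that is, $C_A$ admits at least one weighting and at least one coweighting with entries in $\mathbb{Q}$), and the magnitude of $C_A$ is $$m(C_A)=p/w.$$
   Context: Magnitude: let $C$ be an $n\times n$ matrix over a commutative ring $R$ and let $u\in R^n$ be the column vector with all entries $1$, with transpose $u^*$. A weighting on $C$ is a column vector $\alpha$ with $C\alpha=u$; a coweighting on $C$ is a row vector $\beta$ with $\beta C=u^*$. $C$ has magnitude if it admits at least one weighting $\alpha$ and at least one coweighting $\beta$; its magnitude is then $m(C)=\sum_i\alpha_i=\sum_i\beta_i$, which is independent of the choices. Nakayama algebras: fix a field $k$; all modules are finite dimensional right modules. Let $\Delta_n$ ($n\ge 1$) be the cyclic quiver with vertices $1,\dots,n$ and arrows $x_a\colon a\to a+1$ for $1\le a\le n-1$ and $x_n\colon n\to 1$. A Nakayama algebra of order $n$ is a finite dimensional algebra $A$ isomorphic to the quotient of the path algebra $k\Delta_n$ by an ideal generated by a finite set of nontrivial paths (arrows are allowed in this set). For a vertex $a$, let $e_a$ be the idempotent, $S_a$ the simple module and $P_a=e_aA$ the indecomposable projective module at $a$; paths are composed so that $e_aA$ is spanned by the paths starting at $a$. Put $p_a=\dim_k P_a$. Let $\tau(a)=a+1$ for $1\le a\le n-1$ and $\tau(n)=1$. The Cartan matrix $C_A=(c_{ab})$ is the $n\times n$ matrix with $c_{ab}=\dim_k(e_bAe_a)$.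 The resolution quiver $R_A$ has vertices $1,\dots,n$ (identified with $S_1,\dots,S_n$) and a unique arrow $a\to\gamma(a)$ for each $a$, where $\gamma(a)=\tau^{p_a}(a)$. For a cycle $I$ in $R_A$, its periodicity $p$ is the number of vertices in $I$ and its weight is $w=\frac1n\sum_{a\in I}p_a$. These are relatively prime integers independent of the cycle chosen, and are called the periodicity and the weight of $R_A$. *)

theory Defs
  imports
    "HOL-Algebra.QuotRing"
    "Jordan_Normal_Form.VS_Connect"
    "Graph_Theory.Arc_Walk"
begin

section \<open>Magnitude of a square matrix\<close>

definition all_ones :: "nat \<Rightarrow> 'a :: comm_ring_1 vec" where
  "all_ones n = vec n (\<lambda>_. 1)"

definition is_weighting :: "'a :: comm_ring_1 mat \<Rightarrow> 'a vec \<Rightarrow> bool" where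
  "is_weighting C \<alpha> \<longleftrightarrow> \<alpha> \<in> carrier_vec (dim_col C) \<and> C *\<^sub>v \<alpha> = all_ones (dim_row C)"

definition is_coweighting :: "'a :: comm_ring_1 mat \<Rightarrow> 'a vec \<Rightarrow> bool" where
  "is_coweighting C \<beta> \<longleftrightarrow>
     \<beta> \<in> carrier_vec (dim_row C) \<and> mat_of_row \<beta> * C = mat_of_row (all_ones (dim_col C))"

definition has_magnitude :: "'a :: comm_ring_1 mat \<Rightarrow> bool" where
  "has_magnitude C \<longleftrightarrow> (\<exists>\<alpha>. is_weighting C \<alpha>) \<and> (\<exists>\<beta>. is_coweighting C \<beta>)"

definition vec_total :: "'a :: comm_ring_1 vec \<Rightarrow> 'a" where
  "vec_total v = (\<Sum>i<dim_vec v. v $ i)"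

definition magnitude :: "'a :: comm_ring_1 mat \<Rightarrow> 'a" where
  "magnitude C = (THE m. \<exists>\<alpha> \<beta>. is_weighting C \<alpha> \<and> is_coweighting C \<beta> \<and>
                               m = vec_total \<alpha> \<and> m = vec_total \<beta>)"

text \<open>The magnitude does not depend on the weighting or coweighting chosen.\<close>

lemma weighting_total_eq_coweighting_total:
  assumes "is_weighting C \<alpha>" "is_coweighting C \<beta>"
  shows "vec_total \<alpha> = vec_total \<beta>"
proof -
  define m n where "m = dim_row C" and "n = dim_col C"
  have C: "C \<in> carrier_mat m n"
    by (auto simp: m_def n_def)
  have a: "\<alpha> \<in> carrier_vec n" "C *\<^sub>v \<alpha> = all_ones m"
    and b: "\<beta> \<in> carrier_vec m" "mat_of_row \<beta> * C = mat_of_row (all_ones n)"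
    using assms by (auto simp: is_weighting_def is_coweighting_def m_def n_def)
  have row: "(\<Sum>j<n. C $$ (i, j) * \<alpha> $ j) = 1" if "i < m" for i
    using arg_cong[OF a(2), of "\<lambda>v. v $ i"] that a(1) C
    by (simp add: all_ones_def scalar_prod_def atLeast0LessThan)
  have col: "(\<Sum>i<m. \<beta> $ i * C $$ (i, j)) = 1" if "j < n" for j
    using arg_cong[OF b(2), of "\<lambda>M. M $$ (0, j)"] that b(1) C
    by (simp add: all_ones_def scalar_prod_def atLeast0LessThan)
  have "vec_total \<alpha> = (\<Sum>j<n. (\<Sum>i<m. \<beta> $ i * C $$ (i, j)) * \<alpha> $ j)"
    using a(1) by (simp add: vec_total_def col)
  also have "\<dots> = (\<Sum>i<m. \<beta> $ i * (\<Sum>j<n. C $$ (i, j) * \<alpha> $ j))"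
    by (simp add: sum_distrib_left sum_distrib_right mult.assoc) (rule sum.swap)
  also have "\<dots> = vec_total \<beta>"
    using b(1) by (simp add: vec_total_def row)
  finally show ?thesis .
qed

lemma magnitude_eq:
  assumes "is_weighting C \<alpha>" "is_coweighting C \<beta>"
  shows "magnitude C = vec_total \<alpha>" "magnitude C = vec_total \<beta>"
proof -
  show "magnitude C = vec_total \<alpha>"
    unfolding magnitude_def
    by (rule the_equality) (use assms weighting_total_eq_coweighting_total in metis)+
  then show "magnitude C = vec_total \<beta>"
    using weighting_total_eq_coweighting_total[OF assms] by simp
qed

section \<open>Path algebras and their quotients\<close>

text \<open>
  A path is stored as (source, list of arrows, target).  Paths are read from left to right:
  the product \<open>p q\<close> is defined if \<open>p\<close> ends where \<open>q\<close> starts, and means "first \<open>p\<close>, then \<open>q\<close>".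
  The trivial path at \<open>v\<close> is \<open>(v, [], v)\<close>.
\<close>

type_synonym ('v, 'e) path = "'v \<times> 'e list \<times> 'v"

definition quiver_paths :: "('v, 'e) pre_digraph \<Rightarrow> ('v, 'e) path set" where
  "quiver_paths Q = {(u, p, v). pre_digraph.awalk Q u p v}"

definition nontrivial_paths :: "('v, 'e) pre_digraph \<Rightarrow> ('v, 'e) path set" where
  "nontrivial_paths Q = {(u, p, v) \<in> quiver_paths Q. p \<noteq> []}"

definition path_factorizations ::
    "('v, 'e) pre_digraph \<Rightarrow> ('v, 'e) path \<Rightarrow> (('v, 'e) path \<times> ('v, 'e) path) set" where
  "path_factorizations Q r =
     {((u, p, v), (v, q, w)) | u p v q w.
        (u, p, v) \<in> quiver_paths Q \<and> (v, q, w) \<in> quiver_paths Q \<and> r = (u, p @ q, w)}"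

text \<open>
  Elements of the path algebra are finitely supported coefficient functions on paths.  The unit is
  the sum of the trivial paths, so this is a unital algebra for quivers with finitely many vertices.
\<close>

definition path_algebra ::
    "('k, 'm) ring_scheme \<Rightarrow> ('v, 'e) pre_digraph \<Rightarrow> ('k, ('v, 'e) path \<Rightarrow> 'k) module" where
  "path_algebra K Q =
     \<lparr>carrier = {f. (\<forall>r. f r \<in> carrier K) \<and> (\<forall>r. r \<notin> quiver_paths Q \<longrightarrow> f r = \<zero>\<^bsub>K\<^esub>) \<and>
                    finite {r. f r \<noteq> \<zero>\<^bsub>K\<^esub>}},
      mult = (\<lambda>f g r. \<Oplus>\<^bsub>K\<^esub>d \<in> path_factorizations Q r. f (fst d) \<otimes>\<^bsub>K\<^esub> g (snd d)),
      one = (\<lambda>r. if \<exists>v \<in> verts Q. r = (v, [], v) then \<one>\<^bsub>K\<^esub> else \<zero>\<^bsub>K\<^esub>),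
      zero = (\<lambda>r. \<zero>\<^bsub>K\<^esub>),
      add = (\<lambda>f g r. f r \<oplus>\<^bsub>K\<^esub> g r),
      smult = (\<lambda>c f r. c \<otimes>\<^bsub>K\<^esub> f r)\<rparr>"

definition path_element :: "('k, 'm) ring_scheme \<Rightarrow> ('v, 'e) path \<Rightarrow> (('v, 'e) path \<Rightarrow> 'k)" where
  "path_element K p = (\<lambda>r. if r = p then \<one>\<^bsub>K\<^esub> else \<zero>\<^bsub>K\<^esub>)"

text \<open>
  The library locale \<open>algebra\<close> only covers commutative algebras.
\<close>

locale assoc_algebra = vectorspace K A + A?: ring A
  for K :: "('k, 'm) ring_scheme" and A :: "('k, 'a, 'z) module_scheme" +
  assumes smult_mult_left:
      "\<lbrakk>c \<in> carrier K; x \<in> carrier A; y \<in> carrier A\<rbrakk> \<Longrightarrow>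
       (c \<odot>\<^bsub>A\<^esub> x) \<otimes>\<^bsub>A\<^esub> y = c \<odot>\<^bsub>A\<^esub> (x \<otimes>\<^bsub>A\<^esub> y)"
    and smult_mult_right:
      "\<lbrakk>c \<in> carrier K; x \<in> carrier A; y \<in> carrier A\<rbrakk> \<Longrightarrow>
       x \<otimes>\<^bsub>A\<^esub> (c \<odot>\<^bsub>A\<^esub> y) = c \<odot>\<^bsub>A\<^esub> (x \<otimes>\<^bsub>A\<^esub> y)"

text \<open>
  \<open>A Quot I\<close> has no scalar multiplication; add the induced one
  \<open>c (I + x) = I + c x\<close>, written independently of the representative \<open>x\<close>.
\<close>

definition quotient_algebra :: "('k, 'a, 'z) module_scheme \<Rightarrow> 'a set \<Rightarrow> ('k, 'a set) module" where
  "quotient_algebra A I =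
     ring.extend (A Quot I)
       (module.fields (\<lambda>c X. \<Union>x\<in>X. I +>\<^bsub>A\<^esub> (c \<odot>\<^bsub>A\<^esub> x)))"

definition algebra_iso ::
    "('k, 'm) ring_scheme \<Rightarrow> ('k, 'a, 'y) module_scheme \<Rightarrow> ('k, 'b, 'z) module_scheme \<Rightarrow>
     ('a \<Rightarrow> 'b) set" where
  "algebra_iso K A B =
     {\<phi> \<in> ring_iso A B. \<forall>c \<in> carrier K. \<forall>x \<in> carrier A. \<phi> (c \<odot>\<^bsub>A\<^esub> x) = c \<odot>\<^bsub>B\<^esub> \<phi> x}"

section \<open>Nakayama algebras\<close>

definition cyc_succ :: "nat \<Rightarrow> nat \<Rightarrow> nat" where
  "cyc_succ n a = (if a = n then 1 else a + 1)"

text \<open>The arrow \<open>a\<close> of the quiver below is the arrow \<open>x\<^sub>a\<close> from \<open>a\<close> to its cyclic successor.\<close>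

definition cyclic_quiver :: "nat \<Rightarrow> (nat, nat) pre_digraph" where
  "cyclic_quiver n = \<lparr>verts = {1..n}, arcs = {1..n}, tail = (\<lambda>a. a), head = cyc_succ n\<rparr>"

text \<open>
  The presentation (the relations \<open>Z\<close> and the isomorphism \<open>\<phi>\<close>) is part of the data: it labels
  the primitive idempotents of \<open>A\<close> by the vertices \<open>1, \<dots>, n\<close>.
\<close>

locale nakayama_algebra = assoc_algebra K A
  for K :: "('k, 'm) ring_scheme" and A :: "('k, 'a, 'z) module_scheme" +
  fixes n :: nat
    and Z :: "(nat, nat) path set"
    and \<phi> :: "((nat, nat) path \<Rightarrow> 'k) set \<Rightarrow> 'a"
  assumes order_pos: "n \<ge> 1"
    and finite_relations: "finite Z"
    and relations_nontrivial: "Z \<subseteq> nontrivial_paths (cyclic_quiver n)"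
    and presentation:
      "\<phi> \<in> algebra_iso K
         (quotient_algebra (path_algebra K (cyclic_quiver n))
           (Idl\<^bsub>path_algebra K (cyclic_quiver n)\<^esub> (path_element K ` Z)))
         A"
    and finite_dimensional: "vectorspace.fin_dim K A"

definition vertex_idempotent ::
    "('k, 'm) ring_scheme \<Rightarrow> nat \<Rightarrow> (nat, nat) path set \<Rightarrow>
     (((nat, nat) path \<Rightarrow> 'k) set \<Rightarrow> 'a) \<Rightarrow> nat \<Rightarrow> 'a" where
  "vertex_idempotent K n Z \<phi> a =
     \<phi> (Idl\<^bsub>path_algebra K (cyclic_quiver n)\<^esub> (path_element K ` Z)
          +>\<^bsub>path_algebra K (cyclic_quiver n)\<^esub> path_element K (a, [], a))"

text \<open>Below, \<open>e\<close> is the family of vertex idempotents of \<open>A\<close>.\<close>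

definition proj_module ::
    "('k, 'a, 'z) module_scheme \<Rightarrow> (nat \<Rightarrow> 'a) \<Rightarrow> nat \<Rightarrow> 'a set" where
  "proj_module A e a = {e a \<otimes>\<^bsub>A\<^esub> x | x. x \<in> carrier A}"

definition proj_dim ::
    "('k, 'm) ring_scheme \<Rightarrow> ('k, 'a, 'z) module_scheme \<Rightarrow> (nat \<Rightarrow> 'a) \<Rightarrow> nat \<Rightarrow> nat" where
  "proj_dim K A e a = vectorspace.dim K (A\<lparr>carrier := proj_module A e a\<rparr>)"

definition corner ::
    "('k, 'a, 'z) module_scheme \<Rightarrow> (nat \<Rightarrow> 'a) \<Rightarrow> nat \<Rightarrow> nat \<Rightarrow> 'a set" where
  "corner A e b a = {e b \<otimes>\<^bsub>A\<^esub> x \<otimes>\<^bsub>A\<^esub> e a | x. x \<in> carrier A}"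

text \<open>
  Matrix indices start at 0, vertices at 1.
\<close>

definition cartan_matrix ::
    "('k, 'm) ring_scheme \<Rightarrow> ('k, 'a, 'z) module_scheme \<Rightarrow> nat \<Rightarrow> (nat \<Rightarrow> 'a) \<Rightarrow> nat mat" where
  "cartan_matrix K A n e =
     mat n n (\<lambda>(i, j). vectorspace.dim K (A\<lparr>carrier := corner A e (j + 1) (i + 1)\<rparr>))"

section \<open>The resolution quiver\<close>

text \<open>
  Each vertex has exactly one outgoing arrow, which is named after the vertex.  Hence a cycle,
  being a list of arrows, is also the list of its vertices.  The argument \<open>p\<close> is the family of
  dimensions of the indecomposable projectives.
\<close>

definition resolution_quiver :: "nat \<Rightarrow> (nat \<Rightarrow> nat) \<Rightarrow> (nat, nat) pre_digraph" where
  "resolution_quiver n p =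
     \<lparr>verts = {1..n}, arcs = {1..n}, tail = (\<lambda>a. a), head = (\<lambda>a. (cyc_succ n ^^ p a) a)\<rparr>"

definition cycle_periodicity :: "nat list \<Rightarrow> nat" where
  "cycle_periodicity I = card (set I)"

definition cycle_weight :: "nat \<Rightarrow> (nat \<Rightarrow> nat) \<Rightarrow> nat list \<Rightarrow> rat" where
  "cycle_weight n p I = (\<Sum>a\<in>set I. of_nat (p a)) / of_nat n"

lemma cyc_succ_pow_in:
  assumes "a \<in> {1..n}"
  shows "(cyc_succ n ^^ k) a \<in> {1..n}"
  using assms by (induction k) (auto simp: cyc_succ_def)

lemma resolution_quiver_has_cycle:
  assumes "n \<ge> 1"
  shows "\<exists>I. pre_digraph.cycle (resolution_quiver n p) I"
proof -
  interpret R: wf_digraph "resolution_quiver n p"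
    by unfold_locales (use cyc_succ_pow_in in \<open>auto simp: resolution_quiver_def\<close>)
  define g where "g = (\<lambda>a. (cyc_succ n ^^ p a) a)"
  define s where "s = (\<lambda>i. (g ^^ i) 1)"
  have s_in: "s i \<in> {1..n}" for i
    by (induction i) (use assms cyc_succ_pow_in in \<open>auto simp: s_def g_def simp del: atLeastAtMost_iff\<close>, auto)
  have walk: "R.awalk (s i) (map s [i..<i + d]) (s (i + d))" for i d
  proof (induction d arbitrary: i)
    case 0
    show ?case
      unfolding R.awalk_def using s_in[of i] by (simp add: resolution_quiver_def pre_digraph.cas.simps)
  next
    case (Suc d)
    have "map s [i..<i + Suc d] = s i # map s [Suc i..<Suc i + d]"
      by (simp add: upt_conv_Cons del: upt_Suc)
    moreover have "head (resolution_quiver n p) (s i) = s (Suc i)"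
      by (simp add: resolution_quiver_def s_def g_def)
    moreover have "s i \<in> arcs (resolution_quiver n p)" "tail (resolution_quiver n p) (s i) = s i"
      using s_in[of i] by (simp_all add: resolution_quiver_def)
    ultimately show ?case
      using Suc.IH[of "Suc i"] by (simp add: R.awalk_Cons_iff)
  qed
  have "\<not> inj s"
  proof
    assume "inj s"
    moreover have "finite (range s)"
      using s_in by (intro finite_subset[of "range s" "{1..n}"]) blast+
    ultimately show False
      using finite_imageD infinite_UNIV_nat by blast
  qed
  then obtain i j where ij: "i < j" "s i = s j"
    by (metis injI linorder_neqE_nat)
  have "R.closed_w (map s [i..<j])"
    unfolding R.closed_w_def using walk[of i "j - i"] ij by auto
  then show ?thesis
    by (rule R.closed_w_imp_cycle)
qed

end

theory Submission
  imports Defs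
begin

text \<open>
  The ideal generated by a set of paths consists of the elements supported on multiples of these
  paths, so the paths outside it give a basis of \<open>A\<close>.  In a cyclic quiver there is one path of each
  length from a given vertex; hence \<open>e\<^sub>a A\<close> has as basis the paths of lengths \<open>0, \<dots>, p\<^sub>a - 1\<close> from \<open>a\<close>, and
  column \<open>a\<close> of the Cartan matrix counts the visits to each vertex of a walk of \<open>p\<^sub>a\<close> steps starting
  at \<open>a\<close>.  Such a walk continues at \<open>\<gamma>(a)\<close>, so the walks along a cycle \<open>I\<close> of the resolution quiver join
  to a closed walk, which winds around the cyclic quiver exactly \<open>w\<close> times and visits every vertex \<open>w\<close>
  times.  Thus \<open>1\<^sub>I / w\<close> is a weighting, with total \<open>p / w\<close>.  A coweighting arises in the same way from
  the paths ending at each vertex, that is, by traversing the quiver backwards.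
\<close>

section \<open>Walks around the cyclic quiver, and the magnitude obtained from their visit
  counts\<close>

section \<open>Cycles of the resolution quiver\<close>

text \<open>The lengths of the nonzero paths from \<open>a\<close> form an initial segment because a
  prefix of a nonzero path is nonzero; the segment is finite because nonzero paths are linearly
  independent in \<open>A\<close>. Suffixes do the same for the paths ending at \<open>b\<close>,
  but the resulting lengths \<open>coproj_dim b\<close> differ in general from the dimensions
  \<open>p b\<close>, so the coweighting takes a cycle of its own. The reflection b -> n + 1 - b
  turns the reversed quiver into a cyclic quiver again, so that the single counting lemma
  \<open>resolution_cycle_visits\<close> serves both sides. The total of the coweighting is then
  forced, as it equals that of any weighting. In the same way p / w comes out equal for all cycles:
  each cycle yields a weighting, and the magnitude is unique. Division by w is legitimate because
  the relations are nontrivial paths: trivial paths survive in \<open>A\<close>, every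
  \<open>p a\<close> is positive, and so is the total over a cycle.\<close>

lemma cyc_succ_pow:
  assumes "a \<in> {1..n}"
  shows "(cyc_succ n ^^ m) a = (a - 1 + m) mod n + 1"
proof (induction m)
  case 0
  then show ?case using assms by auto
next
  case (Suc m)
  have "n > 0" using assms by auto
  then have "cyc_succ n ((a - 1 + m) mod n + 1) = (a - 1 + Suc m) mod n + 1"
    using mod_Suc[of "a - 1 + m" n] by (auto simp: cyc_succ_def)
  then show ?case using Suc by simp
qed

text \<open>The congruence is solved for \<open>m\<close>; since subtraction of naturals truncates,
  \<open>n\<close> is added when \<open>b\<close> lies before \<open>a\<close>. The solution depends
  only on the difference of \<open>a\<close> and \<open>b\<close> modulo \<open>n\<close>, which is
  how \<open>cyc_succ_pow_reflect\<close> compares two such congruences.\<close>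

lemma add_mod_eq_iff:
  fixes a b m n :: nat
  assumes "a < n" "b < n"
  shows "(a + m) mod n = b \<longleftrightarrow> m mod n = (if a \<le> b then b - a else b + n - a)"
proof -
  define r where "r = m mod n"
  have r: "r < n" using assms by (simp add: r_def)
  have m: "(a + m) mod n = (a + r) mod n" by (simp add: r_def mod_add_right_eq)
  show ?thesis
  proof (cases "a + r < n")
    case True
    then show ?thesis using assms unfolding m by (fold r_def) auto
  next
    case False
    then have "(a + r) mod n = a + r - n"
      using assms r by (simp add: le_mod_geq)
    then show ?thesis using assms r False unfolding m by (fold r_def) auto
  qed
qed

text \<open>The first \<open>n * w\<close> numbers fall into \<open>w\<close> blocks of length
  \<open>n\<close>, and each block contains one number of the form \<open>n * i + r\<close>.\<close>

lemma card_residue_class: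
  fixes n r w :: nat
  assumes "r < n"
  shows "card {m. m < n * w \<and> m mod n = r} = w"
proof -
  have "{m. m < n * w \<and> m mod n = r} = (\<lambda>i. n * i + r) ` {..<w}"
  proof (intro equalityI subsetI)
    fix m assume m: "m \<in> {m. m < n * w \<and> m mod n = r}"
    then have "m = n * (m div n) + r" "m div n < w"
      using assms by (auto simp: less_mult_imp_div_less mult.commute)
    then show "m \<in> (\<lambda>i. n * i + r) ` {..<w}" by blast
  next
    fix m assume "m \<in> (\<lambda>i. n * i + r) ` {..<w}"
    then obtain i where i: "i < w" "m = n * i + r" by blast
    have "n * i + r < n * (i + 1)" using assms by simp
    also have "\<dots> \<le> n * w" using i by (intro mult_le_mono2) simp
    finally show "m \<in> {m. m < n * w \<and> m mod n = r}" using i assms by simp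
  qed
  moreover have "inj_on (\<lambda>i. n * i + r) {..<w}"
    using assms by (auto simp: inj_on_def)
  ultimately show ?thesis by (simp add: card_image)
qed

text \<open>Being at \<open>b\<close> after \<open>m\<close> steps is a condition on
  \<open>m\<close> modulo \<open>n\<close>, so \<open>w\<close> full turns meet it \<open>w\<close>
  times. Independence of \<open>b\<close> is what makes the product of the matrix with an indicator
  vector constant.\<close>

lemma card_visits:
  assumes "a \<in> {1..n}" "b \<in> {1..n}"
  shows "card {m. m < n * w \<and> (cyc_succ n ^^ m) a = b} = w"
proof -
  have "(cyc_succ n ^^ m) a = b \<longleftrightarrow> m mod n = (if a \<le> b then b - a else b + n - a)" for m
  proof -
    have "(if a - 1 \<le> b - 1 then b - 1 - (a - 1) else b - 1 + n - (a - 1))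
        = (if a \<le> b then b - a else b + n - a)"
      using assms by auto
    moreover have "(cyc_succ n ^^ m) a = b \<longleftrightarrow> (a - 1 + m) mod n = b - 1"
      using assms unfolding cyc_succ_pow[OF assms(1)] by auto
    moreover have "a - 1 < n" "b - 1 < n" using assms by auto
    ultimately show ?thesis
      using add_mod_eq_iff[of "a - 1" n "b - 1" m] by (simp only:)
  qed
  moreover have "(if a \<le> b then b - a else b + n - a) < n"
    using assms by auto
  ultimately show ?thesis
    by (simp only: card_residue_class)
qed

text \<open>A closed walk consists of whole turns; this supplies the integer
  \<open>w\<close>.\<close>

lemma cyc_succ_pow_fixed:
  assumes "a \<in> {1..n}" "(cyc_succ n ^^ t) a = a"
  shows "n dvd t"
proof -
  have "(a - 1 + t) mod n = a - 1"
    using assms by (auto simp: cyc_succ_pow)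
  then have "t mod n = 0"
    using assms add_mod_eq_iff[of "a - 1" n "a - 1" t] by auto
  then show ?thesis by auto
qed

text \<open>Visits in the second stretch are counted from its own start, which is the form needed to
  append one more arrow of a resolution walk.\<close>

lemma card_split_less:
  fixes s t :: nat
  shows "card {m. m < s + t \<and> P m} = card {m. m < s \<and> P m} + card {m. m < t \<and> P (s + m)}"
proof -
  have "{m. m < s + t \<and> P m} = {m. m < s \<and> P m} \<union> (+) s ` {m. m < t \<and> P (s + m)}"
  proof (intro equalityI subsetI)
    fix m assume m: "m \<in> {m. m < s + t \<and> P m}"
    show "m \<in> {m. m < s \<and> P m} \<union> (+) s ` {m. m < t \<and> P (s + m)}"
    proof (cases "m < s")
      case False
      then have "m = s + (m - s)" "m - s \<in> {m. m < t \<and> P (s + m)}" using m by auto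
      then show ?thesis by blast
    qed (use m in auto)
  qed auto
  moreover have "{m. m < s \<and> P m} \<inter> (+) s ` {m. m < t \<and> P (s + m)} = {}" by auto
  moreover have "card ((+) s ` {m. m < t \<and> P (s + m)}) = card {m. m < t \<and> P (s + m)}"
    by (intro card_image) simp
  ultimately show ?thesis
    by (simp add: card_Un_disjoint)
qed

text \<open>
  Concatenating the stretches \<open>x, \<tau>(x), \<dots>, \<tau>\<^bsup>p x - 1\<^esup>(x)\<close> along a walk of the resolution quiver gives
  one uninterrupted run around the cyclic quiver.
\<close>

lemma resolution_walk_visits:
  assumes "pre_digraph.awalk (resolution_quiver n p) u xs v"
  shows "(cyc_succ n ^^ (\<Sum>x\<leftarrow>xs. p x)) u = v"
    and "(\<Sum>x\<leftarrow>xs. card {m. m < p x \<and> (cyc_succ n ^^ m) x = b})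
       = card {m. m < (\<Sum>x\<leftarrow>xs. p x) \<and> (cyc_succ n ^^ m) u = b}"
proof -
  \<comment> \<open>The induction runs over \<open>cas\<close>, the recursive part of
    \<open>awalk\<close>, with the start vertex left free: after the arrow \<open>u\<close> the walk
    continues at \<open>(cyc_succ n ^^ p u) u\<close>.\<close>
  have "(cyc_succ n ^^ (\<Sum>x\<leftarrow>xs. p x)) u = v \<and> (\<Sum>x\<leftarrow>xs. card {m. m < p x \<and> (cyc_succ n ^^ m) x = b})
       = card {m. m < (\<Sum>x\<leftarrow>xs. p x) \<and> (cyc_succ n ^^ m) u = b}"
    if "pre_digraph.cas (resolution_quiver n p) u xs v"
    using that
  proof (induction xs arbitrary: u)
    case Nil
    then show ?case by (simp add: pre_digraph.cas.simps)
  next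
    case (Cons x xs)
    have u: "x = u" and "pre_digraph.cas (resolution_quiver n p) ((cyc_succ n ^^ p u) u) xs v"
      using Cons.prems by (auto simp: pre_digraph.cas.simps resolution_quiver_def)
    moreover have "(cyc_succ n ^^ (k + m)) u = (cyc_succ n ^^ m) ((cyc_succ n ^^ k) u)" for k m
      by (simp add: add.commute[of k m] funpow_add)
    ultimately show ?case
      using Cons.IH unfolding u by (simp add: card_split_less)
  qed
  then show "(cyc_succ n ^^ (\<Sum>x\<leftarrow>xs. p x)) u = v"
    and "(\<Sum>x\<leftarrow>xs. card {m. m < p x \<and> (cyc_succ n ^^ m) x = b})
       = card {m. m < (\<Sum>x\<leftarrow>xs. p x) \<and> (cyc_succ n ^^ m) u = b}"
    using assms by (auto simp: pre_digraph.awalk_def)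
qed

lemma wf_resolution_quiver: "wf_digraph (resolution_quiver n p)"
  by unfold_locales (use cyc_succ_pow_in in \<open>auto simp: resolution_quiver_def\<close>)

lemma resolution_cycle_visits:
  assumes "pre_digraph.cycle (resolution_quiver n p) I"
  obtains w where "set I \<subseteq> {1..n}" "set I \<noteq> {}" "(\<Sum>a\<in>set I. p a) = n * w"
    "\<And>b. b \<in> {1..n} \<Longrightarrow> (\<Sum>a\<in>set I. card {m. m < p a \<and> (cyc_succ n ^^ m) a = b}) = w"
proof -
  let ?Q = "resolution_quiver n p"
  obtain u where walk: "pre_digraph.awalk ?Q u I u" and ne: "I \<noteq> []"
    and dist: "distinct (tl (pre_digraph.awalk_verts ?Q u I))"
    using assms by (auto simp: pre_digraph.cycle_def)
  have u: "u \<in> {1..n}" and sub: "set I \<subseteq> {1..n}" and cas: "pre_digraph.cas ?Q u I u"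
    using walk by (auto simp: pre_digraph.awalk_def resolution_quiver_def)
  \<comment> \<open>Arrows carry the names of their sources, so \<open>I\<close> lists the vertices
    met before the return to \<open>u\<close>. A cycle only guarantees distinctness of the vertex
    list without its head; that list is the tail of \<open>I\<close> followed by \<open>u\<close>,
    and \<open>u\<close> is the head of \<open>I\<close>. Hence \<open>I\<close> is distinct, and
    sums over the list become sums over \<open>set I\<close>.\<close>
  have "pre_digraph.awalk_verts ?Q u I = I @ [head ?Q (last I)]"
    using ne by (simp add: pre_digraph.awalk_verts_conv) (simp add: resolution_quiver_def)
  then have "pre_digraph.awalk_verts ?Q u I = I @ [u]"
    using wf_digraph.awlast_if_cas[OF wf_resolution_quiver cas] by simp
  moreover have "hd I = u"
    using cas ne by (cases I) (auto simp: pre_digraph.cas.simps resolution_quiver_def)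
  ultimately have "distinct I"
    using dist ne by (cases I) auto
  then have sums: "(\<Sum>x\<leftarrow>I. f x) = (\<Sum>a\<in>set I. f a)" for f :: "nat \<Rightarrow> nat"
    by (rule sum_list_distinct_conv_sum_set)
  obtain w where w: "(\<Sum>a\<in>set I. p a) = n * w"
    using cyc_succ_pow_fixed[OF u resolution_walk_visits(1)[OF walk]] by (auto simp: sums)
  have "(\<Sum>a\<in>set I. card {m. m < p a \<and> (cyc_succ n ^^ m) a = b}) = w" if "b \<in> {1..n}" for b
    using resolution_walk_visits(2)[OF walk, of b] card_visits[OF u that, of w] by (simp add: sums w)
  then show thesis
    using that sub ne w by auto
qed

text \<open>Bridges two numberings: matrix and vector indices start at 0, vertices at 1.\<close>

lemma sum_indicator_shift:
  fixes f :: "nat \<Rightarrow> rat"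
  assumes "S \<subseteq> {1..n}"
  shows "(\<Sum>i<n. if i + 1 \<in> S then f (i + 1) else 0) = (\<Sum>a\<in>S. f a)"
proof -
  have "(\<Sum>i<n. if i + 1 \<in> S then f (i + 1) else 0) = (\<Sum>i\<in>{i \<in> {..<n}. i + 1 \<in> S}. f (i + 1))"
    by (intro sum.inter_filter[symmetric]) simp
  also have "\<dots> = (\<Sum>a\<in>S. f a)"
    by (rule sum.reindex_bij_witness[of _ "\<lambda>a. a - 1" "\<lambda>i. i + 1"]) (use assms in \<open>force+\<close>)
  finally show ?thesis .
qed

text \<open>
  Reversing the orientation of the cyclic quiver by \<open>b \<mapsto> n + 1 - b\<close> turns the nonzero paths ending at
  a vertex into paths starting at a vertex, so that cycles for the lengths \<open>q\<close> give coweightings.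
\<close>

lemma cyclic_cartan_magnitude:
  fixes C :: "rat mat" and c :: "nat \<Rightarrow> nat \<Rightarrow> nat"
  assumes n: "n \<ge> 1"
    and C: "C = mat n n (\<lambda>(i, j). rat_of_nat (c (j + 1) (i + 1)))"
    and pos: "\<And>a. a \<in> {1..n} \<Longrightarrow> p a > 0" "\<And>b. b \<in> {1..n} \<Longrightarrow> q b > 0"
    and cp: "\<And>a b. a \<in> {1..n} \<Longrightarrow> b \<in> {1..n} \<Longrightarrow>
               c a b = card {m. m < p a \<and> (cyc_succ n ^^ m) a = b}"
    and cq: "\<And>a b. a \<in> {1..n} \<Longrightarrow> b \<in> {1..n} \<Longrightarrow>
               c a b = card {m. m < q b \<and> (cyc_succ n ^^ m) (n + 1 - b) = n + 1 - a}"
  shows "has_magnitude C"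
    and "pre_digraph.cycle (resolution_quiver n p) I \<Longrightarrow>
         magnitude C = rat_of_nat (cycle_periodicity I) / cycle_weight n p I"
proof -
  have weighting: "\<exists>\<alpha>. is_weighting C \<alpha> \<and>
      vec_total \<alpha> = rat_of_nat (cycle_periodicity I) / cycle_weight n p I"
    if cyc: "pre_digraph.cycle (resolution_quiver n p) I" for I
  proof -
    obtain w where sub: "set I \<subseteq> {1..n}" and ne: "set I \<noteq> {}" and w: "(\<Sum>a\<in>set I. p a) = n * w"
      and vis: "\<And>b. b \<in> {1..n} \<Longrightarrow>
        (\<Sum>a\<in>set I. card {m. m < p a \<and> (cyc_succ n ^^ m) a = b}) = w"
      using resolution_cycle_visits[OF cyc] by blast
    have "(\<Sum>a\<in>set I. p a) > 0"
      using sub ne pos(1) by (intro sum_pos) auto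
    then have w0: "w > 0" using w by auto
    define \<alpha> :: "rat vec" where "\<alpha> = vec n (\<lambda>j. if j + 1 \<in> set I then 1 / of_nat w else 0)"
    have row: "(\<Sum>j<n. rat_of_nat (c (j + 1) (i + 1)) * (if j + 1 \<in> set I then 1 / of_nat w else 0)) = 1"
      if i: "i < n" for i
    proof -
      have "(\<Sum>j<n. rat_of_nat (c (j + 1) (i + 1)) * (if j + 1 \<in> set I then 1 / of_nat w else 0))
          = (\<Sum>j<n. if j + 1 \<in> set I then rat_of_nat (c (j + 1) (i + 1)) / of_nat w else 0)"
        by (intro sum.cong) auto
      also have "\<dots> = (\<Sum>a\<in>set I. rat_of_nat (c a (i + 1)) / of_nat w)"
        by (rule sum_indicator_shift[OF sub])
      also have "\<dots> = of_nat (\<Sum>a\<in>set I. c a (i + 1)) / of_nat w"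
        by (simp add: sum_divide_distrib)
      also have "(\<Sum>a\<in>set I. c a (i + 1)) = w"
        using i sub by (subst vis[of "i + 1", symmetric]) (auto intro!: sum.cong cp)
      finally show ?thesis using w0 by simp
    qed
    have "is_weighting C \<alpha>"
      unfolding is_weighting_def
    proof (intro conjI eq_vecI)
      fix i assume "i < dim_vec (all_ones (dim_row C) :: rat vec)"
      then have "i < n" by (simp add: all_ones_def C)
      then show "(C *\<^sub>v \<alpha>) $ i = all_ones (dim_row C) $ i"
        using row[of i] by (simp add: C \<alpha>_def all_ones_def scalar_prod_def atLeast0LessThan)
    qed (simp_all add: C \<alpha>_def all_ones_def)
    moreover have "vec_total \<alpha> = of_nat (card (set I)) / of_nat w"
      using sum_indicator_shift[OF sub, of "\<lambda>_. 1 / of_nat w"] by (simp add: vec_total_def \<alpha>_def)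
    moreover have "cycle_weight n p I = of_nat w"
      using w n by (simp add: cycle_weight_def flip: of_nat_sum)
    ultimately show ?thesis
      by (auto simp: cycle_periodicity_def)
  qed
  have "\<exists>\<beta>. is_coweighting C \<beta>"
  proof -
    \<comment> \<open>\<open>J\<close> is a cycle for the lengths \<open>q\<close> read at reflected
      vertices. Its own vertices are therefore reflected ones, and \<open>?r\<close> carries them
      back to the indices of \<open>C\<close>; this is why \<open>\<beta>\<close> is supported on
      the image of \<open>set J\<close> under \<open>?r\<close>.\<close>
    let ?r = "\<lambda>a. n + 1 - a"
    obtain J where cyc: "pre_digraph.cycle (resolution_quiver n (q \<circ> ?r)) J"
      using resolution_quiver_has_cycle[OF n] by blast
    obtain w where sub: "set J \<subseteq> {1..n}" and ne: "set J \<noteq> {}" and w: "(\<Sum>a\<in>set J. q (?r a)) = n * w"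
      and vis: "\<And>b. b \<in> {1..n} \<Longrightarrow>
        (\<Sum>a\<in>set J. card {m. m < q (?r a) \<and> (cyc_succ n ^^ m) a = b}) = w"
      using resolution_cycle_visits[OF cyc] by auto
    have "(\<Sum>a\<in>set J. q (?r a)) > 0"
    proof (intro sum_pos)
      fix a assume "a \<in> set J"
      then have "a \<in> {1..n}" using sub by blast
      then have "?r a \<in> {1..n}" by auto
      then show "0 < q (?r a)" by (rule pos(2))
    qed (use ne in auto)
    then have w0: "w > 0" using w by auto
    have rr: "?r (?r a) = a" if "a \<in> {1..n}" for a using that by auto
    have sub': "?r ` set J \<subseteq> {1..n}"
    proof (intro image_subsetI)
      fix a assume "a \<in> set J"
      then have "a \<in> {1..n}" using sub by blast
      then show "?r a \<in> {1..n}" by auto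
    qed
    have inj: "inj_on ?r (set J)"
      by (rule inj_on_inverseI[of _ ?r]) (use sub rr in blast)
    define \<beta> :: "rat vec" where "\<beta> = vec n (\<lambda>i. if i + 1 \<in> ?r ` set J then 1 / of_nat w else 0)"
    have col: "(\<Sum>i<n. (if i + 1 \<in> ?r ` set J then 1 / of_nat w else 0) * rat_of_nat (c (j + 1) (i + 1))) = 1"
      if j: "j < n" for j
    proof -
      have "(\<Sum>i<n. (if i + 1 \<in> ?r ` set J then 1 / of_nat w else 0) * rat_of_nat (c (j + 1) (i + 1)))
          = (\<Sum>i<n. if i + 1 \<in> ?r ` set J then rat_of_nat (c (j + 1) (i + 1)) / of_nat w else 0)"
        by (intro sum.cong) auto
      also have "\<dots> = (\<Sum>b\<in>?r ` set J. rat_of_nat (c (j + 1) b) / of_nat w)"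
        by (rule sum_indicator_shift[OF sub'])
      also have "\<dots> = of_nat (\<Sum>a\<in>set J. c (j + 1) (?r a)) / of_nat w"
        unfolding sum.reindex[OF inj] by (simp add: sum_divide_distrib)
      \<comment> \<open>This is \<open>cq\<close> at the vertex \<open>?r a\<close>, whose
        reflection is \<open>a\<close> again: column \<open>j\<close> becomes the number of visits
        to \<open>?r (j + 1)\<close> along the closed walk of \<open>J\<close>.\<close>
      also have "(\<Sum>a\<in>set J. c (j + 1) (?r a))
          = (\<Sum>a\<in>set J. card {m. m < q (?r a) \<and> (cyc_succ n ^^ m) a = ?r (j + 1)})"
      proof (intro sum.cong refl)
        fix a assume "a \<in> set J"
        then have a: "a \<in> {1..n}" using sub by blast
        then have "?r a \<in> {1..n}" by auto
        then show "c (j + 1) (?r a) = card {m. m < q (?r a) \<and> (cyc_succ n ^^ m) a = ?r (j + 1)}"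
          using cq[of "j + 1" "?r a"] j by (simp only: rr[OF a]) auto
      qed
      also have "\<dots> = w"
        using j by (intro vis) auto
      finally show ?thesis using w0 by simp
    qed
    have "is_coweighting C \<beta>"
      unfolding is_coweighting_def
    proof (intro conjI eq_matI)
      fix i j assume ij: "i < dim_row (mat_of_row (all_ones (dim_col C) :: rat vec))"
        "j < dim_col (mat_of_row (all_ones (dim_col C) :: rat vec))"
      then have "i = 0" "j < n" by (auto simp: all_ones_def C)
      then show "(mat_of_row \<beta> * C) $$ (i, j) = mat_of_row (all_ones (dim_col C)) $$ (i, j)"
        using col[of j] by (simp add: C \<beta>_def all_ones_def scalar_prod_def atLeast0LessThan)
    qed (simp_all add: C \<beta>_def all_ones_def)
    then show ?thesis by blast
  qed
  then obtain \<beta> where \<beta>: "is_coweighting C \<beta>" by blast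
  obtain I\<^sub>0 where "pre_digraph.cycle (resolution_quiver n p) I\<^sub>0"
    using resolution_quiver_has_cycle[OF n] by blast
  with weighting \<beta> show "has_magnitude C"
    by (auto simp: has_magnitude_def)
  show "magnitude C = rat_of_nat (cycle_periodicity I) / cycle_weight n p I"
    if "pre_digraph.cycle (resolution_quiver n p) I"
    using weighting[OF that] magnitude_eq(1) \<beta> by metis
qed

section \<open>The path algebra of a quiver with finitely many vertices as a unital ring\<close>

section \<open>Path algebras\<close>

lemma (in abelian_monoid) finsum_single:
  assumes "finite A" "i \<in> A" "f \<in> A \<rightarrow> carrier G" "\<And>j. j \<in> A \<Longrightarrow> j \<noteq> i \<Longrightarrow> f j = \<zero>"
  shows "(\<Oplus>j\<in>A. f j) = f i"
proof -
  have "(\<Oplus>j\<in>A. f j) = (\<Oplus>j\<in>{i}. f j)"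
    by (rule add.finprod_mono_neutral_cong_right) (use assms in auto)
  also have "\<dots> = f i"
    using assms by (simp add: Pi_def)
  finally show ?thesis .
qed

text \<open>Turns a double sum whose inner range depends on the outer index into a sum over pairs;
  associativity of the path product compares two double sums of this kind.\<close>

lemma (in abelian_monoid) finsum_Sigma:
  assumes "finite I" "\<And>i. i \<in> I \<Longrightarrow> finite (B i)"
    and "\<And>i j. i \<in> I \<Longrightarrow> j \<in> B i \<Longrightarrow> f i j \<in> carrier G"
  shows "(\<Oplus>i\<in>I. \<Oplus>j\<in>B i. f i j) = (\<Oplus>x\<in>Sigma I B. f (fst x) (snd x))"
  using assms
proof (induction I rule: finite_induct)
  case empty
  then show ?case by simp
next
  case (insert i I)
  have "Sigma (insert i I) B = Pair i ` B i \<union> Sigma I B"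
    by auto
  moreover have "(\<Oplus>x\<in>Pair i ` B i. f (fst x) (snd x)) = (\<Oplus>j\<in>B i. f i j)"
    using insert.prems by (subst finsum_reindex) (auto simp: inj_on_def)
  moreover have "(\<Oplus>x\<in>Pair i ` B i \<union> Sigma I B. f (fst x) (snd x))
      = (\<Oplus>x\<in>Pair i ` B i. f (fst x) (snd x)) \<oplus> (\<Oplus>x\<in>Sigma I B. f (fst x) (snd x))"
    using insert by (intro finsum_Un_disjoint) auto
  ultimately show ?case
    using insert by (simp add: Pi_def finsum_closed)
qed

text \<open>Finiteness of the vertex set gives the unit, the sum of all trivial paths, a finite
  support. The sums defining a product are finite because a path can be cut in only finitely many
  places.\<close>

locale quiver_over_field = field K + wf_digraph Q
  for K :: "('k, 'm) ring_scheme" (structure) and Q :: "('v, 'e) pre_digraph" +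
  assumes finite_verts: "finite (verts Q)"
begin

abbreviation PA :: "('k, ('v, 'e) path \<Rightarrow> 'k) module" where
  "PA \<equiv> path_algebra K Q"

lemma quiver_path_iff [simp]: "(u, p, v) \<in> quiver_paths Q \<longleftrightarrow> awalk u p v"
  by (simp add: quiver_paths_def)

lemma factorization_iff [simp]:
  "((u, p, v), (v', q, w)) \<in> path_factorizations Q (a, l, b) \<longleftrightarrow>
     v' = v \<and> u = a \<and> w = b \<and> l = p @ q \<and> awalk u p v \<and> awalk v q w"
  by (auto simp: path_factorizations_def)

lemma awalk_ends_in_verts:
  assumes "awalk u p v"
  shows "u \<in> verts Q" "v \<in> verts Q"
  using assms by - (erule awalkE', assumption)+

text \<open>A factorization is determined by the position of the cut in the arrow list;
  \<open>awlast\<close> recovers the vertex at the cut.\<close>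

lemma finite_factorizations [simp]: "finite (path_factorizations Q r)"
proof -
  obtain u l w where r: "r = (u, l, w)" by (cases r) auto
  let ?h = "\<lambda>k. ((u, take k l, awlast u (take k l)), (awlast u (take k l), drop k l, w))"
  have "path_factorizations Q r \<subseteq> ?h ` {..length l}"
  proof
    fix d assume d: "d \<in> path_factorizations Q r"
    obtain u' p v v' q w' where d_eq: "d = ((u', p, v), (v', q, w'))"
      by (metis surj_pair)
    then have "v' = v" "u' = u" "w' = w" "l = p @ q" "awlast u p = v"
      using d unfolding r by auto
    then have "d = ?h (length p)" "length p \<le> length l"
      by (simp_all add: d_eq)
    then show "d \<in> ?h ` {..length l}" by blast
  qed
  then show ?thesis
    by (rule finite_subset) simp
qed

lemma factorizations_non_path:
  assumes "r \<notin> quiver_paths Q"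
  shows "path_factorizations Q r = {}"
proof (rule equals0I)
  fix d assume "d \<in> path_factorizations Q r"
  then obtain u p v q w where "awalk u p v" "awalk v q w" "r = (u, p @ q, w)"
    by (auto simp: path_factorizations_def)
  then show False
    using assms awalk_appendI[of u p v q w] by (simp del: awalk_append_iff)
qed

lemma path_algebra_carrier_iff:
  "f \<in> carrier PA \<longleftrightarrow> (\<forall>r. f r \<in> carrier K) \<and> (\<forall>r. r \<notin> quiver_paths Q \<longrightarrow> f r = \<zero>) \<and>
     finite {r. f r \<noteq> \<zero>}"
  by (simp add: path_algebra_def)

lemma path_algebra_coeff [simp]: "f \<in> carrier PA \<Longrightarrow> f r \<in> carrier K"
  unfolding path_algebra_carrier_iff by blast

lemma path_algebra_off_paths: "f \<in> carrier PA \<Longrightarrow> r \<notin> quiver_paths Q \<Longrightarrow> f r = \<zero>"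
  unfolding path_algebra_carrier_iff by blast

lemma path_algebra_finite_support: "f \<in> carrier PA \<Longrightarrow> finite {r. f r \<noteq> \<zero>}"
  unfolding path_algebra_carrier_iff by blast

lemma path_algebra_memI:
  assumes "\<And>r. f r \<in> carrier K" "\<And>r. r \<notin> quiver_paths Q \<Longrightarrow> f r = \<zero>" "finite {r. f r \<noteq> \<zero>}"
  shows "f \<in> carrier PA"
  unfolding path_algebra_carrier_iff using assms by blast

lemma path_algebra_mult:
  "(f \<otimes>\<^bsub>PA\<^esub> g) r = (\<Oplus>d\<in>path_factorizations Q r. f (fst d) \<otimes> g (snd d))"
  by (simp only: path_algebra_def monoid.simps)

lemma path_algebra_ops:
  "\<one>\<^bsub>PA\<^esub> = (\<lambda>r. if \<exists>v \<in> verts Q. r = (v, [], v) then \<one> else \<zero>)"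
  "\<zero>\<^bsub>PA\<^esub> = (\<lambda>r. \<zero>)" "f \<oplus>\<^bsub>PA\<^esub> g = (\<lambda>r. f r \<oplus> g r)" "c \<odot>\<^bsub>PA\<^esub> f = (\<lambda>r. c \<otimes> f r)"
  by (simp_all only: path_algebra_def monoid.simps ring.simps module.simps)

lemma path_algebra_mult_closed:
  assumes f: "f \<in> carrier PA" and g: "g \<in> carrier PA"
  shows "f \<otimes>\<^bsub>PA\<^esub> g \<in> carrier PA"
proof (rule path_algebra_memI)
  show "(f \<otimes>\<^bsub>PA\<^esub> g) r \<in> carrier K" for r
    unfolding path_algebra_mult using f g by (intro finsum_closed) auto
  show "(f \<otimes>\<^bsub>PA\<^esub> g) r = \<zero>" if "r \<notin> quiver_paths Q" for r
    using that by (simp add: path_algebra_mult factorizations_non_path)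
  let ?S = "\<lambda>f. {r. f r \<noteq> \<zero>}"
  have "?S (f \<otimes>\<^bsub>PA\<^esub> g) \<subseteq> (\<lambda>((u, p, v), (v', q, w)). (u, p @ q, w)) ` (?S f \<times> ?S g)"
  proof
    fix r assume r: "r \<in> ?S (f \<otimes>\<^bsub>PA\<^esub> g)"
    have "\<exists>d\<in>path_factorizations Q r. f (fst d) \<otimes> g (snd d) \<noteq> \<zero>"
    proof (rule ccontr)
      assume "\<not> ?thesis"
      then have "(f \<otimes>\<^bsub>PA\<^esub> g) r = \<zero>"
        unfolding path_algebra_mult by (intro add.finprod_one_eqI) auto
      then show False using r by simp
    qed
    then obtain d where d: "d \<in> path_factorizations Q r" "f (fst d) \<otimes> g (snd d) \<noteq> \<zero>"
      by blast
    then have "f (fst d) \<noteq> \<zero>" "g (snd d) \<noteq> \<zero>"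
      using f g by auto
    moreover obtain u p v v' q w where "d = ((u, p, v), (v', q, w))"
      by (metis surj_pair)
    moreover have "r = (u, p @ q, w)"
      using d(1) \<open>d = _\<close> by (cases r) auto
    ultimately show "r \<in> (\<lambda>((u, p, v), (v', q, w)). (u, p @ q, w)) ` (?S f \<times> ?S g)"
      by force
  qed
  then show "finite (?S (f \<otimes>\<^bsub>PA\<^esub> g))"
    by (rule finite_subset) (intro finite_imageI finite_cartesian_product path_algebra_finite_support f g)
qed

text \<open>Both sides sum over the ways to cut \<open>r\<close> into three pieces. A point of
  \<open>?L\<close> cuts \<open>r\<close> and then the left piece, a point of \<open>?R\<close> cuts
  \<open>r\<close> and then the right piece; \<open>?\<theta>\<close> regroups the same three
  pieces, with inverse \<open>?\<theta>'\<close>.\<close>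

lemma path_algebra_mult_assoc:
  assumes f: "f \<in> carrier PA" and g: "g \<in> carrier PA" and h: "h \<in> carrier PA"
  shows "(f \<otimes>\<^bsub>PA\<^esub> g) \<otimes>\<^bsub>PA\<^esub> h = f \<otimes>\<^bsub>PA\<^esub> (g \<otimes>\<^bsub>PA\<^esub> h)"
proof
  fix r
  let ?F = "path_factorizations Q"
  let ?L = "Sigma (?F r) (\<lambda>d. ?F (fst d))" and ?R = "Sigma (?F r) (\<lambda>d. ?F (snd d))"
  let ?\<theta> = "\<lambda>(((u, p, v), (v', q, w)), (a, (b, p', b'))). ((a, (b, p' @ q, w)), ((b, p', b'), (v', q, w)))"
  let ?\<theta>' = "\<lambda>(((u, p, v), (v', q, w)), ((c, p', c'), b)). (((u, p @ p', c'), b), ((u, p, v), (c, p', c')))"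
  have "((f \<otimes>\<^bsub>PA\<^esub> g) \<otimes>\<^bsub>PA\<^esub> h) r
      = (\<Oplus>d\<in>?F r. \<Oplus>d'\<in>?F (fst d). f (fst d') \<otimes> g (snd d') \<otimes> h (snd d))"
    unfolding path_algebra_mult
    using f g h by (intro finsum_cong') (auto intro!: finsum_ldistr finsum_closed)
  also have "\<dots> = (\<Oplus>x\<in>?L. f (fst (snd x)) \<otimes> g (snd (snd x)) \<otimes> h (snd (fst x)))"
    using f g h by (intro finsum_Sigma) auto
  also have "\<dots> = (\<Oplus>x\<in>?L. f (fst (fst (?\<theta> x))) \<otimes> (g (fst (snd (?\<theta> x))) \<otimes> h (snd (snd (?\<theta> x)))))"
    using f g h by (intro finsum_cong') (auto simp: m_assoc split: prod.splits)
  also have "\<dots> = (\<Oplus>x\<in>?\<theta> ` ?L. f (fst (fst x)) \<otimes> (g (fst (snd x)) \<otimes> h (snd (snd x))))"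
  proof (intro finsum_reindex[symmetric])
    show "inj_on ?\<theta> ?L"
      by (rule inj_on_inverseI[of _ ?\<theta>']) (cases r; auto)
  qed (use f g h in auto)
  also have "?\<theta> ` ?L = ?R"
  proof (intro equalityI subsetI)
    fix x assume "x \<in> ?\<theta> ` ?L"
    then show "x \<in> ?R" by (cases r) (auto intro: awalk_appendI)
  next
    fix x assume "x \<in> ?R"
    then have "x = ?\<theta> (?\<theta>' x)" "?\<theta>' x \<in> ?L"
      by (cases r; auto intro: awalk_appendI)+
    then show "x \<in> ?\<theta> ` ?L" by (rule image_eqI)
  qed
  also have "(\<Oplus>x\<in>?R. f (fst (fst x)) \<otimes> (g (fst (snd x)) \<otimes> h (snd (snd x))))
      = (\<Oplus>d\<in>?F r. \<Oplus>d'\<in>?F (snd d). f (fst d) \<otimes> (g (fst d') \<otimes> h (snd d')))"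
    using f g h by (intro finsum_Sigma[symmetric]) auto
  also have "\<dots> = (f \<otimes>\<^bsub>PA\<^esub> (g \<otimes>\<^bsub>PA\<^esub> h)) r"
    unfolding path_algebra_mult
    using f g h by (intro finsum_cong') (auto intro!: finsum_rdistr[symmetric] finsum_closed)
  finally show "((f \<otimes>\<^bsub>PA\<^esub> g) \<otimes>\<^bsub>PA\<^esub> h) r = (f \<otimes>\<^bsub>PA\<^esub> (g \<otimes>\<^bsub>PA\<^esub> h)) r" .
qed

text \<open>Only the factorization whose first piece is trivial survives. Covered by this are the
  unit, the vertex idempotents and the scalar multiples of a trivial path.\<close>

lemma trivial_mult_left:
  assumes f: "f \<in> carrier PA" and g: "g \<in> carrier PA"
    and triv: "\<And>u p v. p \<noteq> [] \<Longrightarrow> g (u, p, v) = \<zero>"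
  shows "(g \<otimes>\<^bsub>PA\<^esub> f) (u, p, v) = g (u, [], u) \<otimes> f (u, p, v)"
proof (cases "awalk u p v")
  case True
  then have "u \<in> verts Q" by (rule awalk_ends_in_verts)
  have "(g \<otimes>\<^bsub>PA\<^esub> f) (u, p, v)
      = (\<lambda>d. g (fst d) \<otimes> f (snd d)) ((u, [], u), (u, p, v))"
    unfolding path_algebra_mult
  proof (rule finsum_single)
    show "((u, [], u), u, p, v) \<in> path_factorizations Q (u, p, v)"
      using True \<open>u \<in> verts Q\<close> by (simp add: awalk_Nil_iff)
    fix d assume d: "d \<in> path_factorizations Q (u, p, v)" "d \<noteq> ((u, [], u), (u, p, v))"
    obtain u' p' v' v'' q w where [simp]: "d = ((u', p', v'), (v'', q, w))"
      by (metis surj_pair)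
    have "p' \<noteq> []"
      using d by (auto simp: awalk_Nil_iff)
    then show "g (fst d) \<otimes> f (snd d) = \<zero>"
      using triv f by simp
  qed (use f g in auto)
  then show ?thesis by simp
next
  case False
  then show ?thesis
    using f g by (auto simp: path_algebra_mult factorizations_non_path path_algebra_off_paths)
qed

lemma trivial_mult_right:
  assumes f: "f \<in> carrier PA" and g: "g \<in> carrier PA"
    and triv: "\<And>u p v. p \<noteq> [] \<Longrightarrow> g (u, p, v) = \<zero>"
  shows "(f \<otimes>\<^bsub>PA\<^esub> g) (u, p, v) = f (u, p, v) \<otimes> g (v, [], v)"
proof (cases "awalk u p v")
  case True
  then have "v \<in> verts Q" by (rule awalk_ends_in_verts)
  have "(f \<otimes>\<^bsub>PA\<^esub> g) (u, p, v)
      = (\<lambda>d. f (fst d) \<otimes> g (snd d)) ((u, p, v), (v, [], v))"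
    unfolding path_algebra_mult
  proof (rule finsum_single)
    show "((u, p, v), (v, [], v)) \<in> path_factorizations Q (u, p, v)"
      using True \<open>v \<in> verts Q\<close> by (simp add: awalk_Nil_iff)
    fix d assume d: "d \<in> path_factorizations Q (u, p, v)" "d \<noteq> ((u, p, v), (v, [], v))"
    obtain u' p' v' v'' q w where [simp]: "d = ((u', p', v'), (v'', q, w))"
      by (metis surj_pair)
    have "q \<noteq> []"
      using d by (auto simp: awalk_Nil_iff)
    then show "f (fst d) \<otimes> g (snd d) = \<zero>"
      using triv f by simp
  qed (use f g in auto)
  then show ?thesis by simp
next
  case False
  then show ?thesis
    using f g by (auto simp: path_algebra_mult factorizations_non_path path_algebra_off_paths)
qed

lemma path_algebra_one_closed: "\<one>\<^bsub>PA\<^esub> \<in> carrier PA"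
proof -
  have "{r. \<exists>v\<in>verts Q. r = (v, [], v)} = (\<lambda>v. (v, [], v)) ` verts Q" by auto
  then have "finite {r :: ('v, 'e) path. \<exists>v\<in>verts Q. r = (v, [], v)}"
    using finite_verts by simp
  then show ?thesis
    by (intro path_algebra_memI) (auto simp: path_algebra_ops awalk_Nil_iff elim: finite_subset[rotated])
qed

lemma ring_path_algebra: "ring PA"
proof (rule ringI)
  have fin: "finite {r. f r \<oplus> g r \<noteq> \<zero>}" if "f \<in> carrier PA" "g \<in> carrier PA" for f g
  proof (rule finite_subset)
    show "{r. f r \<oplus> g r \<noteq> \<zero>} \<subseteq> {r. f r \<noteq> \<zero>} \<union> {r. g r \<noteq> \<zero>}" by auto
  qed (intro finite_UnI path_algebra_finite_support that)
  have minus: "(\<lambda>r. \<ominus> f r) \<in> carrier PA" if "f \<in> carrier PA" for f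
  proof -
    have "{r. \<ominus> f r \<noteq> \<zero>} \<subseteq> {r. f r \<noteq> \<zero>}" by auto
    then have "finite {r. \<ominus> f r \<noteq> \<zero>}"
      by (rule finite_subset) (rule path_algebra_finite_support[OF that])
    then show ?thesis
      using that by (intro path_algebra_memI) (auto simp: path_algebra_off_paths)
  qed
  show "abelian_group PA"
  proof (rule abelian_groupI)
    fix f g assume "f \<in> carrier PA" "g \<in> carrier PA"
    then show "f \<oplus>\<^bsub>PA\<^esub> g \<in> carrier PA"
      using fin[of f g] unfolding path_algebra_ops
      by (intro path_algebra_memI) (auto simp: path_algebra_off_paths)
  next
    show "\<zero>\<^bsub>PA\<^esub> \<in> carrier PA"
      unfolding path_algebra_ops by (intro path_algebra_memI) auto
  next
    fix f assume f: "f \<in> carrier PA"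
    then have "(\<lambda>r. \<ominus> f r) \<oplus>\<^bsub>PA\<^esub> f = \<zero>\<^bsub>PA\<^esub>"
      by (auto simp: path_algebra_ops l_neg)
    then show "\<exists>g\<in>carrier PA. g \<oplus>\<^bsub>PA\<^esub> f = \<zero>\<^bsub>PA\<^esub>"
      using minus[OF f] by blast
  qed (auto simp: path_algebra_ops a_assoc intro!: ext a_comm)
  show "monoid PA"
  proof (rule monoidI)
    fix f assume f: "f \<in> carrier PA"
    \<comment> \<open>The unit has no coefficient at vertices outside \<open>verts Q\<close>, so
      \<open>f\<close> has to vanish on paths starting or ending there.\<close>
    have vert: "f (u, p, v) = \<zero>" if "u \<notin> verts Q \<or> v \<notin> verts Q" for u p v
      using f that awalk_ends_in_verts path_algebra_off_paths[of f "(u, p, v)"] by auto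
    show "\<one>\<^bsub>PA\<^esub> \<otimes>\<^bsub>PA\<^esub> f = f"
    proof
      fix r :: "('v, 'e) path"
      obtain u p v where r: "r = (u, p, v)" by (cases r)
      show "(\<one>\<^bsub>PA\<^esub> \<otimes>\<^bsub>PA\<^esub> f) r = f r"
        unfolding r using f vert[of u v p]
        using trivial_mult_left[OF f path_algebra_one_closed, of u p v] by (auto simp: path_algebra_ops(1))
    qed
    show "f \<otimes>\<^bsub>PA\<^esub> \<one>\<^bsub>PA\<^esub> = f"
    proof
      fix r :: "('v, 'e) path"
      obtain u p v where r: "r = (u, p, v)" by (cases r)
      show "(f \<otimes>\<^bsub>PA\<^esub> \<one>\<^bsub>PA\<^esub>) r = f r"
        unfolding r using f vert[of u v p]
        using trivial_mult_right[OF f path_algebra_one_closed, of u p v] by (auto simp: path_algebra_ops(1))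
    qed
  qed (auto simp: path_algebra_mult_closed path_algebra_mult_assoc path_algebra_one_closed)
  fix f g h assume fgh: "f \<in> carrier PA" "g \<in> carrier PA" "h \<in> carrier PA"
  show "(f \<oplus>\<^bsub>PA\<^esub> g) \<otimes>\<^bsub>PA\<^esub> h = f \<otimes>\<^bsub>PA\<^esub> h \<oplus>\<^bsub>PA\<^esub> g \<otimes>\<^bsub>PA\<^esub> h"
  proof
    show "((f \<oplus>\<^bsub>PA\<^esub> g) \<otimes>\<^bsub>PA\<^esub> h) r = (f \<otimes>\<^bsub>PA\<^esub> h \<oplus>\<^bsub>PA\<^esub> g \<otimes>\<^bsub>PA\<^esub> h) r" for r
      unfolding path_algebra_ops path_algebra_mult
      using fgh by (simp add: l_distr finsum_addf Pi_def)
  qed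
  show "h \<otimes>\<^bsub>PA\<^esub> (f \<oplus>\<^bsub>PA\<^esub> g) = h \<otimes>\<^bsub>PA\<^esub> f \<oplus>\<^bsub>PA\<^esub> h \<otimes>\<^bsub>PA\<^esub> g"
  proof
    show "(h \<otimes>\<^bsub>PA\<^esub> (f \<oplus>\<^bsub>PA\<^esub> g)) r = (h \<otimes>\<^bsub>PA\<^esub> f \<oplus>\<^bsub>PA\<^esub> h \<otimes>\<^bsub>PA\<^esub> g) r" for r
      unfolding path_algebra_ops path_algebra_mult
      using fgh by (simp add: r_distr finsum_addf Pi_def)
  qed
qed

end

section \<open>Ideals generated by paths, described through supports\<close>

section \<open>Monomial ideals\<close>

definition path_multiples :: "('v, 'e) pre_digraph \<Rightarrow> ('v, 'e) path set \<Rightarrow> ('v, 'e) path set" where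
  "path_multiples Q Z = {(u, p @ z @ q, v) | u p x z y q v.
     (u, p, x) \<in> quiver_paths Q \<and> (x, z, y) \<in> Z \<and> (y, q, v) \<in> quiver_paths Q}"

context quiver_over_field
begin

lemma path_multiplesI:
  "awalk u p x \<Longrightarrow> (x, z, y) \<in> Z \<Longrightarrow> awalk y q v \<Longrightarrow> (u, p @ z @ q, v) \<in> path_multiples Q Z"
  by (force simp: path_multiples_def)

lemma path_multiplesE:
  assumes "r \<in> path_multiples Q Z"
  obtains u p x z y q v where "r = (u, p @ z @ q, v)" "awalk u p x" "(x, z, y) \<in> Z" "awalk y q v"
  using assms by (auto simp: path_multiples_def)

lemma path_multiples_append_left:
  assumes "awalk a l u" "(u, m, v) \<in> path_multiples Q Z"
  shows "(a, l @ m, v) \<in> path_multiples Q Z"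
proof -
  obtain p x z y q where "m = p @ z @ q" "awalk u p x" "(x, z, y) \<in> Z" "awalk y q v"
    using assms(2) by (auto elim: path_multiplesE)
  then show ?thesis
    using path_multiplesI[of a "l @ p" x z y Z q v] awalk_appendI[OF assms(1), of p x] by simp
qed

lemma path_multiples_append_right:
  assumes "(u, m, v) \<in> path_multiples Q Z" "awalk v l b"
  shows "(u, m @ l, b) \<in> path_multiples Q Z"
proof -
  obtain p x z y q where "m = p @ z @ q" "awalk u p x" "(x, z, y) \<in> Z" "awalk y q v"
    using assms(1) by (auto elim: path_multiplesE)
  then show ?thesis
    using path_multiplesI[of u p x z y Z "q @ l" b] awalk_appendI[of y q v l b] assms(2) by simp
qed

lemma path_multiples_paths:
  assumes "Z \<subseteq> quiver_paths Q"
  shows "path_multiples Q Z \<subseteq> quiver_paths Q"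
proof
  fix r assume "r \<in> path_multiples Q Z"
  then obtain u p x z y q v where r: "r = (u, p @ z @ q, v)"
    and "awalk u p x" "(x, z, y) \<in> Z" "awalk y q v"
    by (rule path_multiplesE)
  moreover have "awalk x z y" using assms \<open>(x, z, y) \<in> Z\<close> by auto
  ultimately have "awalk u (p @ (z @ q)) v"
    by (intro awalk_appendI)
  then show "r \<in> quiver_paths Q" unfolding r quiver_path_iff .
qed

lemma path_element_closed:
  assumes "r \<in> quiver_paths Q"
  shows "path_element K r \<in> carrier PA"
  using assms by (intro path_algebra_memI) (auto simp: path_element_def)

lemma path_element_mult:
  assumes "awalk u p x" "awalk x q v"
  shows "path_element K (u, p, x) \<otimes>\<^bsub>PA\<^esub> path_element K (x, q, v) = path_element K (u, p @ q, v)"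
proof
  fix r
  let ?f = "\<lambda>d. path_element K (u, p, x) (fst d) \<otimes> path_element K (x, q, v) (snd d)"
  let ?d = "((u, p, x), (x, q, v))"
  have zero: "?f d = \<zero>" if "d \<noteq> ?d" for d
    using that by (cases d) (auto simp: path_element_def)
  show "(path_element K (u, p, x) \<otimes>\<^bsub>PA\<^esub> path_element K (x, q, v)) r = path_element K (u, p @ q, v) r"
  proof (cases "r = (u, p @ q, v)")
    case True
    then have "?d \<in> path_factorizations Q r" using assms by simp
    then have "(\<Oplus>d\<in>path_factorizations Q r. ?f d) = ?f ?d"
      using zero by (intro finsum_single) (auto simp: path_element_def)
    then show ?thesis by (simp add: path_algebra_mult True path_element_def)
  next
    case False
    then have "?d \<notin> path_factorizations Q r"
      by (cases r) auto
    then have "(\<Oplus>d\<in>path_factorizations Q r. ?f d) = \<zero>"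
      using zero by (intro add.finprod_one_eqI) metis
    then show ?thesis using False by (simp add: path_algebra_mult path_element_def)
  qed
qed

text \<open>An ideal is closed under multiplication by ring elements. Writing a scalar multiple of a
  path as a ring product makes that closure apply to scalars as well.\<close>

lemma smult_path_element:
  assumes "awalk u p v" "c \<in> carrier K"
  shows "(\<lambda>r. if r = (u, p, v) then c else \<zero>)
      = (\<lambda>r. if r = (u, [], u) then c else \<zero>) \<otimes>\<^bsub>PA\<^esub> path_element K (u, p, v)"
proof
  fix r :: "('v, 'e) path"
  obtain a l b where r: "r = (a, l, b)" by (cases r)
  have "(\<lambda>r. if r = (u, [], u) then c else \<zero>) \<in> carrier PA"
    using assms by (intro path_algebra_memI) (auto simp: awalk_Nil_iff dest: awalk_ends_in_verts)
  then show "(if r = (u, p, v) then c else \<zero>) =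
      ((\<lambda>r. if r = (u, [], u) then c else \<zero>) \<otimes>\<^bsub>PA\<^esub> path_element K (u, p, v)) r"
    unfolding r using assms
    by (subst trivial_mult_left) (auto simp: path_element_closed, auto simp: path_element_def)
qed

lemma path_algebra_uminus:
  assumes f: "f \<in> carrier PA"
  shows "(\<ominus>\<^bsub>PA\<^esub> f) r = \<ominus> (f r)"
proof -
  interpret P: ring PA by (rule ring_path_algebra)
  have "(f \<oplus>\<^bsub>PA\<^esub> (\<ominus>\<^bsub>PA\<^esub> f)) r = \<zero>"
    using f by (simp add: P.r_neg) (simp add: path_algebra_ops)
  then have "f r \<oplus> (\<ominus>\<^bsub>PA\<^esub> f) r = \<zero>"
    by (simp add: path_algebra_ops)
  then show ?thesis
    using f P.a_inv_closed[OF f] path_algebra_coeff by (metis a_comm minus_equality)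
qed

text \<open>If \<open>r\<close> is not a multiple of a relation, then neither is any factor of
  \<open>r\<close>; hence every term of a product at \<open>r\<close> vanishes as soon as one of the
  two elements is supported on multiples.\<close>

lemma monomial_ideal:
  assumes Z: "Z \<subseteq> quiver_paths Q"
  shows "ideal {f \<in> carrier PA. \<forall>r. r \<notin> path_multiples Q Z \<longrightarrow> f r = \<zero>} PA" (is "ideal ?J PA")
proof -
  interpret P: ring PA by (rule ring_path_algebra)
  show ?thesis
  proof (rule idealI[OF ring_path_algebra])
    show "subgroup ?J (add_monoid PA)"
    proof (rule P.add.subgroupI)
      show "?J \<noteq> {}" using P.zero_closed by (auto simp: path_algebra_ops)
      show "\<ominus>\<^bsub>PA\<^esub> f \<in> ?J" if "f \<in> ?J" for f
        using that by (auto simp: path_algebra_uminus)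
      show "f \<oplus>\<^bsub>PA\<^esub> g \<in> ?J" if "f \<in> ?J" "g \<in> ?J" for f g
        using that P.a_closed[of f g] by (auto simp: path_algebra_ops)
    qed auto
    fix f g assume f: "f \<in> ?J" and g: "g \<in> carrier PA"
    show "g \<otimes>\<^bsub>PA\<^esub> f \<in> ?J"
    proof (intro CollectI conjI allI impI)
      fix r assume r: "r \<notin> path_multiples Q Z"
      show "(g \<otimes>\<^bsub>PA\<^esub> f) r = \<zero>"
        unfolding path_algebra_mult
      proof (rule add.finprod_one_eqI)
        fix d assume d: "d \<in> path_factorizations Q r"
        then have "snd d \<notin> path_multiples Q Z"
          using r path_multiples_append_left by (auto simp: path_factorizations_def)
        then have "f (snd d) = \<zero>" using f by blast
        then show "g (fst d) \<otimes> f (snd d) = \<zero>" using g by simp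
      qed
    qed (use f g in auto)
    show "f \<otimes>\<^bsub>PA\<^esub> g \<in> ?J"
    proof (intro CollectI conjI allI impI)
      fix r assume r: "r \<notin> path_multiples Q Z"
      show "(f \<otimes>\<^bsub>PA\<^esub> g) r = \<zero>"
        unfolding path_algebra_mult
      proof (rule add.finprod_one_eqI)
        fix d assume d: "d \<in> path_factorizations Q r"
        then have "fst d \<notin> path_multiples Q Z"
          using r path_multiples_append_right by (auto simp: path_factorizations_def)
        then have "f (fst d) = \<zero>" using f by blast
        then show "f (fst d) \<otimes> g (snd d) = \<zero>" using g by simp
      qed
    qed (use f g in auto)
  qed
qed

text \<open>One inclusion is minimality of the generated ideal. For the other, each multiple of a
  relation is a product of three path elements, and an element of finite support is a sum of scalar
  multiples of paths.\<close>

lemma genideal_path_elements: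
  assumes Z: "Z \<subseteq> quiver_paths Q"
  shows "Idl\<^bsub>PA\<^esub> (path_element K ` Z) = {f \<in> carrier PA. \<forall>r. r \<notin> path_multiples Q Z \<longrightarrow> f r = \<zero>}"
    (is "?I = ?J")
proof (rule equalityI)
  interpret P: ring PA by (rule ring_path_algebra)
  have mult: "r \<in> path_multiples Q Z" if r: "r \<in> Z" for r
  proof -
    obtain u p v where [simp]: "r = (u, p, v)" by (cases r)
    have "awalk u p v" using r Z by auto
    then show ?thesis
      using path_multiplesI[of u "[]" u p v Z "[]" v] r by (auto simp: awalk_Nil_iff dest: awalk_ends_in_verts)
  qed
  have carr: "path_element K ` Z \<subseteq> carrier PA"
    using Z path_element_closed by auto
  then show "?I \<subseteq> ?J"
    by (intro P.genideal_minimal[OF monomial_ideal[OF Z]]) (auto simp: path_element_def dest: mult)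
  interpret I: ideal ?I PA
    using carr by (rule P.genideal_ideal)
  have elem: "path_element K r \<in> ?I" if r_mult: "r \<in> path_multiples Q Z" for r
  proof -
    obtain u p x z y q v where r: "r = (u, p @ z @ q, v)"
      and w: "awalk u p x" "(x, z, y) \<in> Z" "awalk y q v"
      using r_mult by (rule path_multiplesE)
    have z: "awalk x z y" using w Z by auto
    have "path_element K (x, z, y) \<in> ?I"
      using P.genideal_self[OF carr] w(2) by auto
    then have "path_element K (u, p, x) \<otimes>\<^bsub>PA\<^esub> (path_element K (x, z, y) \<otimes>\<^bsub>PA\<^esub> path_element K (y, q, v)) \<in> ?I"
      using w by (intro I.I_l_closed I.I_r_closed) (auto intro: path_element_closed)
    then show ?thesis
      unfolding r path_element_mult[OF z w(3)] path_element_mult[OF w(1) awalk_appendI[OF z w(3)]] .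
  qed
  \<comment> \<open>The induction is over a finite set \<open>S\<close> containing the support, so
    that \<open>s\<close> can be removed whether or not \<open>f s\<close> is zero. Below,
    \<open>?g\<close> deletes the coefficient at \<open>s\<close>, and \<open>?c\<close> is
    \<open>f s\<close> times the trivial path at the source of \<open>s\<close>.\<close>
  have "f \<in> ?I" if "finite S" "S \<subseteq> path_multiples Q Z" "f \<in> carrier PA" "{r. f r \<noteq> \<zero>} \<subseteq> S" for S f
    using that
  proof (induction S arbitrary: f rule: finite_induct)
    case empty
    then have "f = \<zero>\<^bsub>PA\<^esub>" by (auto simp: path_algebra_ops)
    then show ?case by (simp add: additive_subgroup.zero_closed[OF I.is_additive_subgroup])
  next
    case (insert s S)
    obtain u p v where s: "s = (u, p, v)" by (cases s)
    have w: "awalk u p v"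
      using insert.prems(1) path_multiples_paths[OF Z] by (auto simp: s)
    let ?g = "f(s := \<zero>)" and ?c = "\<lambda>r. if r = (u, [], u) then f s else \<zero>"
    have supp: "{r. ?g r \<noteq> \<zero>} \<subseteq> S" using insert.prems by auto
    have g: "?g \<in> carrier PA"
      using insert.prems finite_subset[OF supp insert.hyps(1)]
      by (intro path_algebra_memI) (auto simp: path_algebra_off_paths)
    have c: "?c \<in> carrier PA"
      using w insert.prems by (intro path_algebra_memI) (auto simp: awalk_Nil_iff dest: awalk_ends_in_verts)
    have f_eq: "f = ?g \<oplus>\<^bsub>PA\<^esub> ?c \<otimes>\<^bsub>PA\<^esub> path_element K s"
      using insert.prems w unfolding s
      by (subst smult_path_element[symmetric]) (auto simp: path_algebra_ops)
    have "?c \<otimes>\<^bsub>PA\<^esub> path_element K s \<in> ?I"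
      using insert.prems elem c by (intro I.I_l_closed) auto
    moreover have "?g \<in> ?I"
      using insert.IH[OF _ g supp] insert.prems by blast
    ultimately show ?case
      by (subst f_eq) (intro additive_subgroup.a_closed[OF I.is_additive_subgroup])
  qed
  then show "?J \<subseteq> ?I"
    using path_algebra_finite_support by blast
qed

end

section \<open>Dimensions in monomial quotients\<close>

text \<open>The coordinate space of functions on \<open>X\<close>. Vanishing off \<open>X\<close>
  makes equality on \<open>X\<close> the same as equality, and for a finite set of paths it gives
  exactly the path algebra elements supported there.\<close>

definition coord_funs :: "('k, 'm) ring_scheme \<Rightarrow> 'x set \<Rightarrow> ('x \<Rightarrow> 'k) set" where
  "coord_funs K X = {f. (\<forall>x. f x \<in> carrier K) \<and> (\<forall>x. x \<notin> X \<longrightarrow> f x = \<zero>\<^bsub>K\<^esub>)}"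

context vectorspace
begin

section \<open>Dimension of a space via a linear injection from a coordinate space\<close>

context
  fixes X :: "'x set" and T :: "('x \<Rightarrow> 'a) \<Rightarrow> 'c"
  assumes finite_X: "finite X"
    and T_closed: "\<And>f. f \<in> coord_funs K X \<Longrightarrow> T f \<in> carrier V"
    and T_add: "\<And>f g. f \<in> coord_funs K X \<Longrightarrow> g \<in> coord_funs K X \<Longrightarrow>
                  T (\<lambda>x. f x \<oplus>\<^bsub>K\<^esub> g x) = T f \<oplus>\<^bsub>V\<^esub> T g"
    and T_smult: "\<And>c f. c \<in> carrier K \<Longrightarrow> f \<in> coord_funs K X \<Longrightarrow>
                  T (\<lambda>x. c \<otimes>\<^bsub>K\<^esub> f x) = c \<odot>\<^bsub>V\<^esub> T f"
    and T_inj: "inj_on T (coord_funs K X)"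
begin

definition unit_image :: "'x \<Rightarrow> 'c" where
  "unit_image x = T (\<lambda>y. if y = x then \<one>\<^bsub>K\<^esub> else \<zero>\<^bsub>K\<^esub>)"

lemma unit_image_closed: "x \<in> X \<Longrightarrow> unit_image x \<in> carrier V"
  unfolding unit_image_def by (rule T_closed) (auto simp: coord_funs_def)

lemma T_zero: "T (\<lambda>x. \<zero>\<^bsub>K\<^esub>) = \<zero>\<^bsub>V\<^esub>"
proof -
  have mem: "(\<lambda>x. \<zero>\<^bsub>K\<^esub>) \<in> coord_funs K X"
    by (simp add: coord_funs_def)
  have "T (\<lambda>x. \<zero>\<^bsub>K\<^esub>) = \<zero>\<^bsub>K\<^esub> \<odot>\<^bsub>V\<^esub> T (\<lambda>x. \<zero>\<^bsub>K\<^esub>)"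
    using T_smult[OF _ mem, of "\<zero>\<^bsub>K\<^esub>"] by simp
  then show ?thesis using T_closed[OF mem] by simp
qed

lemma T_expansion:
  assumes f: "f \<in> coord_funs K X"
  shows "T f = (\<Oplus>\<^bsub>V\<^esub>x\<in>X. f x \<odot>\<^bsub>V\<^esub> unit_image x)"
proof -
  have fK [simp]: "f x \<in> carrier K" for x
    using f by (simp add: coord_funs_def)
  have "(\<Oplus>\<^bsub>V\<^esub>x\<in>Y. f x \<odot>\<^bsub>V\<^esub> unit_image x) = T (\<lambda>x. if x \<in> Y then f x else \<zero>\<^bsub>K\<^esub>)"
    if "finite Y" "Y \<subseteq> X" for Y
    using that
  proof (induction Y rule: finite_induct)
    case empty
    then show ?case by (simp add: T_zero)
  next
    case (insert y Y)
    have mem: "(\<lambda>x. if x = y then f y else \<zero>\<^bsub>K\<^esub>) \<in> coord_funs K X"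
      "(\<lambda>x. if x \<in> Y then f x else \<zero>\<^bsub>K\<^esub>) \<in> coord_funs K X"
      "(\<lambda>x. if x = y then \<one>\<^bsub>K\<^esub> else \<zero>\<^bsub>K\<^esub>) \<in> coord_funs K X"
      using insert.prems by (auto simp: coord_funs_def)
    have "f y \<odot>\<^bsub>V\<^esub> unit_image y = T (\<lambda>x. f y \<otimes>\<^bsub>K\<^esub> (if x = y then \<one>\<^bsub>K\<^esub> else \<zero>\<^bsub>K\<^esub>))"
      unfolding unit_image_def by (rule T_smult[symmetric]) (use mem in auto)
    also have "(\<lambda>x. f y \<otimes>\<^bsub>K\<^esub> (if x = y then \<one>\<^bsub>K\<^esub> else \<zero>\<^bsub>K\<^esub>)) = (\<lambda>x. if x = y then f y else \<zero>\<^bsub>K\<^esub>)"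
      by auto
    finally have "(\<Oplus>\<^bsub>V\<^esub>x\<in>insert y Y. f x \<odot>\<^bsub>V\<^esub> unit_image x)
        = T (\<lambda>x. if x = y then f y else \<zero>\<^bsub>K\<^esub>) \<oplus>\<^bsub>V\<^esub> T (\<lambda>x. if x \<in> Y then f x else \<zero>\<^bsub>K\<^esub>)"
      using insert unit_image_closed T_closed[OF mem(1)] by (subst finsum_insert) auto
    also have "\<dots> = T (\<lambda>x. (if x = y then f y else \<zero>\<^bsub>K\<^esub>) \<oplus>\<^bsub>K\<^esub> (if x \<in> Y then f x else \<zero>\<^bsub>K\<^esub>))"
      by (rule T_add[symmetric]) (use mem in auto)
    also have "(\<lambda>x. (if x = y then f y else \<zero>\<^bsub>K\<^esub>) \<oplus>\<^bsub>K\<^esub> (if x \<in> Y then f x else \<zero>\<^bsub>K\<^esub>))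
        = (\<lambda>x. if x \<in> insert y Y then f x else \<zero>\<^bsub>K\<^esub>)"
      using insert.hyps by auto
    finally show ?case .
  qed
  moreover have "(\<lambda>x. if x \<in> X then f x else \<zero>\<^bsub>K\<^esub>) = f"
    using f by (auto simp: coord_funs_def)
  ultimately show ?thesis
    using finite_X by simp
qed

lemma inj_unit_image: "inj_on unit_image X"
proof (rule inj_onI)
  fix x y assume xy: "x \<in> X" "y \<in> X" "unit_image x = unit_image y"
  have "(\<lambda>z. if z = x then \<one>\<^bsub>K\<^esub> else \<zero>\<^bsub>K\<^esub>) = (\<lambda>z. if z = y then \<one>\<^bsub>K\<^esub> else \<zero>\<^bsub>K\<^esub>)"
    by (rule inj_onD[OF T_inj]) (use xy in \<open>auto simp: coord_funs_def unit_image_def\<close>)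
  then show "x = y"
    using fun_cong[of "\<lambda>z. if z = x then \<one>\<^bsub>K\<^esub> else \<zero>\<^bsub>K\<^esub>" _ x] one_not_zero
    by (auto split: if_splits)
qed

text \<open>Coefficients in \<open>lincomb\<close> are indexed by vectors; injectivity of
  \<open>unit_image\<close> lets them be indexed by \<open>X\<close>, so that a linear combination
  becomes a value of \<open>T\<close>.\<close>

lemma lincomb_unit_image:
  assumes "a \<in> unit_image ` X \<rightarrow> carrier K"
  shows "lincomb a (unit_image ` X) = T (\<lambda>x. if x \<in> X then a (unit_image x) else \<zero>\<^bsub>K\<^esub>)"
proof -
  have aK: "a (unit_image x) \<in> carrier K" if "x \<in> X" for x
    using assms that by auto
  have "lincomb a (unit_image ` X) = (\<Oplus>\<^bsub>V\<^esub>x\<in>X. a (unit_image x) \<odot>\<^bsub>V\<^esub> unit_image x)"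
    unfolding lincomb_def
    by (rule finsum_reindex) (use assms inj_unit_image unit_image_closed in auto)
  also have "\<dots> = (\<Oplus>\<^bsub>V\<^esub>x\<in>X. (if x \<in> X then a (unit_image x) else \<zero>\<^bsub>K\<^esub>) \<odot>\<^bsub>V\<^esub> unit_image x)"
    by (rule finsum_cong') (use aK unit_image_closed in auto)
  also have "\<dots> = T (\<lambda>x. if x \<in> X then a (unit_image x) else \<zero>\<^bsub>K\<^esub>)"
    by (rule T_expansion[symmetric]) (use assms in \<open>auto simp: coord_funs_def\<close>)
  finally show ?thesis .
qed

lemma lin_indpt_unit_image: "lin_indpt (unit_image ` X)"
proof (rule finite_lin_indpt2)
  fix a assume a: "a \<in> unit_image ` X \<rightarrow> carrier K" "lincomb a (unit_image ` X) = \<zero>\<^bsub>V\<^esub>"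
  have "(\<lambda>x. if x \<in> X then a (unit_image x) else \<zero>\<^bsub>K\<^esub>) = (\<lambda>x. \<zero>\<^bsub>K\<^esub>)"
    by (rule inj_onD[OF T_inj])
      (use a lincomb_unit_image[OF a(1)] T_zero in \<open>auto simp: coord_funs_def\<close>)
  then show "\<forall>v\<in>unit_image ` X. a v = \<zero>\<^bsub>K\<^esub>"
    by (auto dest: fun_cong split: if_splits)
qed (use finite_X unit_image_closed in auto)

lemma card_coords_le_dim: "fin_dim \<Longrightarrow> card X \<le> dim"
  using li_le_dim(2)[OF _ _ lin_indpt_unit_image] unit_image_closed card_image[OF inj_unit_image]
  by auto

lemma dim_eq_card_coords:
  assumes surj: "T ` coord_funs K X = carrier V"
  shows "dim = card X"
proof -
  let ?S = "unit_image ` X"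
  have S: "finite ?S" "?S \<subseteq> carrier V"
    using finite_X unit_image_closed by auto
  have "carrier V \<subseteq> span ?S"
  proof
    fix v assume "v \<in> carrier V"
    then obtain f where f: "f \<in> coord_funs K X" and v: "v = T f"
      using surj by blast
    \<comment> \<open>The coefficient of a basis vector is the coordinate of \<open>f\<close> at the
      unique index giving that vector.\<close>
    define a where "a = (\<lambda>s. f (inv_into X unit_image s))"
    have a: "a (unit_image x) = f x" if "x \<in> X" for x
      using that inj_unit_image by (simp add: a_def)
    have aK: "a \<in> ?S \<rightarrow> carrier K"
      using f by (simp add: a_def coord_funs_def)
    have "(\<lambda>x. if x \<in> X then a (unit_image x) else \<zero>\<^bsub>K\<^esub>) = f"
      using f a by (auto simp: coord_funs_def)
    then have "lincomb a ?S = v"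
      using lincomb_unit_image[OF aK] v by simp
    then show "v \<in> span ?S"
      using aK S by (auto simp: finite_span)
  qed
  then have "basis ?S"
    using S lin_indpt_unit_image span_is_subset2 unfolding basis_def by blast
  then show ?thesis
    using dim_basis[OF S(1)] card_image[OF inj_unit_image] by simp
qed

end

end

lemma quotient_algebra_ops:
  "carrier (quotient_algebra B I) = carrier (B Quot I)"
  "mult (quotient_algebra B I) = mult (B Quot I)"
  "add (quotient_algebra B I) = add (B Quot I)"
  "smult (quotient_algebra B I) = (\<lambda>c X. \<Union>x\<in>X. I +>\<^bsub>B\<^esub> (c \<odot>\<^bsub>B\<^esub> x))"
  by (simp_all add: quotient_algebra_def ring.extend_def module.fields_def)

lemma (in quiver_over_field) path_algebra_smult_closed:
  assumes "c \<in> carrier K" "f \<in> carrier PA"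
  shows "c \<odot>\<^bsub>PA\<^esub> f \<in> carrier PA"
proof -
  have "{r. c \<otimes> f r \<noteq> \<zero>} \<subseteq> {r. f r \<noteq> \<zero>}" using assms by auto
  then have "finite {r. c \<otimes> f r \<noteq> \<zero>}"
    by (rule finite_subset) (rule path_algebra_finite_support[OF assms(2)])
  then show ?thesis
    unfolding path_algebra_ops using assms
    by (intro path_algebra_memI) (auto simp: path_algebra_off_paths)
qed

section \<open>The quotient map onto the algebra and the dimensions of the spaces it cuts
  out\<close>

locale monomial_quotient = quiver_over_field K Q + A: assoc_algebra K A
  for K :: "('k, 'm) ring_scheme" (structure) and Q :: "('v, 'e) pre_digraph"
    and A :: "('k, 'a, 'z) module_scheme" +
  fixes Z :: "('v, 'e) path set"
    and \<phi> :: "(('v, 'e) path \<Rightarrow> 'k) set \<Rightarrow> 'a"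
  assumes relations_paths: "Z \<subseteq> quiver_paths Q"
    and presentation:
      "\<phi> \<in> algebra_iso K (quotient_algebra PA (Idl\<^bsub>PA\<^esub> (path_element K ` Z))) A"
begin

abbreviation relation_ideal :: "(('v, 'e) path \<Rightarrow> 'k) set" where
  "relation_ideal \<equiv> Idl\<^bsub>PA\<^esub> (path_element K ` Z)"

definition quot_map :: "(('v, 'e) path \<Rightarrow> 'k) \<Rightarrow> 'a" where
  "quot_map f = \<phi> (relation_ideal +>\<^bsub>PA\<^esub> f)"

definition nonzero_paths :: "('v, 'e) path set" where
  "nonzero_paths = quiver_paths Q - path_multiples Q Z"

definition supported_on :: "('v, 'e) path set \<Rightarrow> (('v, 'e) path \<Rightarrow> 'k) set" where
  "supported_on B = {f \<in> carrier PA. \<forall>r. r \<notin> B \<longrightarrow> f r = \<zero>}"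

lemma ideal_relation_ideal: "ideal relation_ideal PA"
  using monomial_ideal[OF relations_paths] by (simp only: genideal_path_elements[OF relations_paths])

lemma relation_ideal_iff:
  "f \<in> relation_ideal \<longleftrightarrow> f \<in> carrier PA \<and> (\<forall>r. r \<notin> path_multiples Q Z \<longrightarrow> f r = \<zero>)"
  unfolding genideal_path_elements[OF relations_paths] by blast

text \<open>The scalar action on cosets is a union over all representatives. The relation ideal is
  closed under scalars, so all representatives give the same coset and the union collapses.\<close>

lemma coset_smult:
  assumes c: "c \<in> carrier K" and f: "f \<in> carrier PA"
  shows "c \<odot>\<^bsub>quotient_algebra PA relation_ideal\<^esub> (relation_ideal +>\<^bsub>PA\<^esub> f)
    = relation_ideal +>\<^bsub>PA\<^esub> (c \<odot>\<^bsub>PA\<^esub> f)"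
proof -
  interpret P: ring PA by (rule ring_path_algebra)
  interpret I: ideal relation_ideal PA by (rule ideal_relation_ideal)
  have "relation_ideal +>\<^bsub>PA\<^esub> (c \<odot>\<^bsub>PA\<^esub> x) = relation_ideal +>\<^bsub>PA\<^esub> (c \<odot>\<^bsub>PA\<^esub> f)"
    if x: "x \<in> relation_ideal +>\<^bsub>PA\<^esub> f" for x
  proof -
    obtain h where h: "h \<in> relation_ideal" and xh: "x = h \<oplus>\<^bsub>PA\<^esub> f"
      using x by (auto simp: a_r_coset_def r_coset_def)
    have hc: "h \<in> carrier PA" using h by (simp add: relation_ideal_iff)
    have "c \<odot>\<^bsub>PA\<^esub> h \<in> relation_ideal"
      using path_algebra_smult_closed[OF c hc] h c
      unfolding relation_ideal_iff by (simp add: path_algebra_ops)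
    moreover have "c \<odot>\<^bsub>PA\<^esub> x = c \<odot>\<^bsub>PA\<^esub> h \<oplus>\<^bsub>PA\<^esub> c \<odot>\<^bsub>PA\<^esub> f"
      using c f hc by (simp add: xh path_algebra_ops r_distr)
    ultimately have "c \<odot>\<^bsub>PA\<^esub> x \<in> relation_ideal +>\<^bsub>PA\<^esub> (c \<odot>\<^bsub>PA\<^esub> f)"
      by (auto simp: a_r_coset_def r_coset_def)
    then show ?thesis
      using P.a_repr_independence[OF _ path_algebra_smult_closed[OF c f] I.a_subgroup] by simp
  qed
  moreover have "f \<in> relation_ideal +>\<^bsub>PA\<^esub> f"
    using f by (rule I.a_rcos_self)
  ultimately show ?thesis
    unfolding quotient_algebra_ops by blast
qed

text \<open>\<open>quot_map\<close> is a surjective algebra map whose kernel is the relation ideal.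
  As that ideal is described by supports, two elements have the same image exactly when they agree
  on \<open>nonzero_paths\<close>.\<close>

lemma
  shows quot_map_closed: "f \<in> carrier PA \<Longrightarrow> quot_map f \<in> carrier A"
    and quot_map_surj: "quot_map ` carrier PA = carrier A"
    and quot_map_add: "f \<in> carrier PA \<Longrightarrow> g \<in> carrier PA \<Longrightarrow>
      quot_map (f \<oplus>\<^bsub>PA\<^esub> g) = quot_map f \<oplus>\<^bsub>A\<^esub> quot_map g"
    and quot_map_mult: "f \<in> carrier PA \<Longrightarrow> g \<in> carrier PA \<Longrightarrow>
      quot_map (f \<otimes>\<^bsub>PA\<^esub> g) = quot_map f \<otimes>\<^bsub>A\<^esub> quot_map g"
    and quot_map_smult: "c \<in> carrier K \<Longrightarrow> f \<in> carrier PA \<Longrightarrow>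
      quot_map (c \<odot>\<^bsub>PA\<^esub> f) = c \<odot>\<^bsub>A\<^esub> quot_map f"
    and quot_map_eq_iff: "f \<in> carrier PA \<Longrightarrow> g \<in> carrier PA \<Longrightarrow>
      quot_map f = quot_map g \<longleftrightarrow> (\<forall>r\<in>nonzero_paths. f r = g r)"
proof -
  interpret P: ring PA by (rule ring_path_algebra)
  interpret I: ideal relation_ideal PA by (rule ideal_relation_ideal)
  let ?R = "quotient_algebra PA relation_ideal"
  have hom: "\<phi> \<in> Ring.ring_hom ?R A" and bij: "bij_betw \<phi> (carrier ?R) (carrier A)"
    and lin: "\<And>c x. c \<in> carrier K \<Longrightarrow> x \<in> carrier ?R \<Longrightarrow> \<phi> (c \<odot>\<^bsub>?R\<^esub> x) = c \<odot>\<^bsub>A\<^esub> \<phi> x"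
    using presentation by (auto simp: algebra_iso_def ring_iso_def)
  have carrier_R: "carrier ?R = (\<lambda>f. relation_ideal +>\<^bsub>PA\<^esub> f) ` carrier PA"
    by (auto simp: quotient_algebra_ops FactRing_def A_RCOSETS_def RCOSETS_def a_r_coset_def)
  then have coset: "relation_ideal +>\<^bsub>PA\<^esub> f \<in> carrier ?R" if "f \<in> carrier PA" for f
    using that by blast
  show "quot_map ` carrier PA = carrier A"
    using bij carrier_R by (auto simp: bij_betw_def quot_map_def image_image)
  then show "quot_map f \<in> carrier A" if "f \<in> carrier PA" for f
    using that by blast
  show "quot_map (f \<oplus>\<^bsub>PA\<^esub> g) = quot_map f \<oplus>\<^bsub>A\<^esub> quot_map g"
    if "f \<in> carrier PA" "g \<in> carrier PA" for f g
    using ring_hom_add[OF hom coset[OF that(1)] coset[OF that(2)]] I.a_rcos_sum[OF that]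
    by (simp add: quot_map_def quotient_algebra_ops FactRing_def)
  show "quot_map (f \<otimes>\<^bsub>PA\<^esub> g) = quot_map f \<otimes>\<^bsub>A\<^esub> quot_map g"
    if "f \<in> carrier PA" "g \<in> carrier PA" for f g
    using ring_hom_mult[OF hom coset[OF that(1)] coset[OF that(2)]] I.rcoset_mult_add[OF that]
    by (simp add: quot_map_def quotient_algebra_ops FactRing_def)
  show "quot_map (c \<odot>\<^bsub>PA\<^esub> f) = c \<odot>\<^bsub>A\<^esub> quot_map f"
    if "c \<in> carrier K" "f \<in> carrier PA" for c f
    using lin[OF that(1) coset[OF that(2)]] coset_smult[OF that] by (simp add: quot_map_def)
  show "quot_map f = quot_map g \<longleftrightarrow> (\<forall>r\<in>nonzero_paths. f r = g r)"
    if fg: "f \<in> carrier PA" "g \<in> carrier PA" for f g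
  proof -
    have "quot_map f = quot_map g \<longleftrightarrow> f \<ominus>\<^bsub>PA\<^esub> g \<in> relation_ideal"
      using P.quotient_eq_iff_same_a_r_cos[OF ideal_relation_ideal fg] coset fg
        inj_on_eq_iff[OF bij_betw_imp_inj_on[OF bij]] by (simp add: quot_map_def)
    also have "\<dots> \<longleftrightarrow> (\<forall>r. r \<notin> path_multiples Q Z \<longrightarrow> f r \<ominus> g r = \<zero>)"
      using fg P.minus_closed[OF fg]
      by (simp add: relation_ideal_iff P.minus_eq minus_eq path_algebra_uminus)
        (simp add: path_algebra_ops path_algebra_uminus)
    also have "\<dots> \<longleftrightarrow> (\<forall>r\<in>nonzero_paths. f r = g r)"
    proof -
      have "f r \<ominus> g r = \<zero> \<longleftrightarrow> f r = g r" for r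
        using fg by simp
      moreover have "f r = g r" if "r \<notin> quiver_paths Q" for r
        using that fg by (simp add: path_algebra_off_paths)
      ultimately show ?thesis
        unfolding nonzero_paths_def by blast
    qed
    finally show ?thesis .
  qed
qed

lemma coord_funs_off: "f \<in> coord_funs K X \<Longrightarrow> x \<notin> X \<Longrightarrow> f x = \<zero>"
  unfolding coord_funs_def by blast

lemma supported_on_off: "f \<in> supported_on B \<Longrightarrow> r \<notin> B \<Longrightarrow> f r = \<zero>"
  unfolding supported_on_def by blast

lemma coord_funs_path_algebra:
  assumes "finite X" "X \<subseteq> quiver_paths Q"
  shows "coord_funs K X = supported_on X"
proof -
  have "finite {r. f r \<noteq> \<zero>}" if "\<forall>r. r \<notin> X \<longrightarrow> f r = \<zero>" for f :: "('v, 'e) path \<Rightarrow> 'k"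
    by (rule finite_subset[OF _ assms(1)]) (use that in blast)
  then show ?thesis
    using assms(2) unfolding supported_on_def coord_funs_def path_algebra_carrier_iff by blast
qed

lemma quot_map_coords:
  assumes "finite X" "X \<subseteq> nonzero_paths"
  shows "\<And>f. f \<in> coord_funs K X \<Longrightarrow> quot_map f \<in> carrier A"
    and "\<And>f g. f \<in> coord_funs K X \<Longrightarrow> g \<in> coord_funs K X \<Longrightarrow>
      quot_map (\<lambda>x. f x \<oplus> g x) = quot_map f \<oplus>\<^bsub>A\<^esub> quot_map g"
    and "\<And>c f. c \<in> carrier K \<Longrightarrow> f \<in> coord_funs K X \<Longrightarrow>
      quot_map (\<lambda>x. c \<otimes> f x) = c \<odot>\<^bsub>A\<^esub> quot_map f"
    and "inj_on quot_map (coord_funs K X)"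
proof -
  have eq: "coord_funs K X = supported_on X"
    using assms by (intro coord_funs_path_algebra) (auto simp: nonzero_paths_def)
  show "quot_map f \<in> carrier A" if "f \<in> coord_funs K X" for f
    using that by (simp add: eq supported_on_def quot_map_closed)
  show "quot_map (\<lambda>x. f x \<oplus> g x) = quot_map f \<oplus>\<^bsub>A\<^esub> quot_map g"
    if "f \<in> coord_funs K X" "g \<in> coord_funs K X" for f g
    using that quot_map_add[of f g] by (simp add: eq supported_on_def path_algebra_ops)
  show "quot_map (\<lambda>x. c \<otimes> f x) = c \<odot>\<^bsub>A\<^esub> quot_map f"
    if "c \<in> carrier K" "f \<in> coord_funs K X" for c f
    using that quot_map_smult[of c f] by (simp add: eq supported_on_def path_algebra_ops)
  show "inj_on quot_map (coord_funs K X)"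
  proof (rule inj_onI)
    fix f g assume fg: "f \<in> coord_funs K X" "g \<in> coord_funs K X" "quot_map f = quot_map g"
    then have "\<forall>r\<in>nonzero_paths. f r = g r"
      using quot_map_eq_iff[of f g] by (simp add: eq supported_on_def)
    moreover have "f r = g r" if "r \<notin> X" for r
      using that fg by (simp add: coord_funs_off)
    ultimately show "f = g"
      using assms(2) by (intro ext) blast
  qed
qed

text \<open>Any finite set of nonzero paths is independent in \<open>A\<close>, so an infinite
  supply would give one path more than the dimension allows.\<close>

lemma finite_nonzero_paths:
  assumes "vectorspace.fin_dim K A"
  shows "finite nonzero_paths"
proof (rule ccontr)
  assume "infinite nonzero_paths"
  then obtain X where X: "X \<subseteq> nonzero_paths" "finite X" "card X = Suc A.dim"
    by (metis infinite_arbitrarily_large)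
  have "card X \<le> A.dim"
    by (rule A.card_coords_le_dim[OF X(2) quot_map_coords[OF X(2,1)] assms])
  then show False using X by simp
qed

text \<open>The nonzero paths in \<open>B\<close> give a basis of the image. It is applied with
  \<open>B\<close> the paths from \<open>a\<close>, for projectives, and the paths from
  \<open>a\<close> to \<open>b\<close>, for Cartan entries.\<close>

lemma dim_quot_map_image:
  assumes fin: "finite (B \<inter> nonzero_paths)"
  shows "vectorspace.dim K (A\<lparr>carrier := quot_map ` supported_on B\<rparr>) = card (B \<inter> nonzero_paths)"
proof -
  let ?X = "B \<inter> nonzero_paths"
  have eq: "coord_funs K ?X = supported_on ?X"
    using fin by (intro coord_funs_path_algebra) (auto simp: nonzero_paths_def)
  have image: "quot_map ` supported_on B = quot_map ` coord_funs K ?X"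
    unfolding eq
  proof (intro equalityI subsetI)
    fix y assume "y \<in> quot_map ` supported_on B"
    then obtain f where f: "f \<in> supported_on B" and y: "y = quot_map f" by blast
    \<comment> \<open>Coefficients at multiples of relations are discarded, which leaves the image
      in \<open>A\<close> unchanged.\<close>
    define g where "g = (\<lambda>r. if r \<in> ?X then f r else \<zero>)"
    have fc: "f \<in> carrier PA" using f by (simp add: supported_on_def)
    have "g \<in> coord_funs K ?X"
      using fc by (simp add: g_def coord_funs_def)
    then have g: "g \<in> supported_on ?X" unfolding eq .
    then have gc: "g \<in> carrier PA" by (simp add: supported_on_def)
    have "quot_map f = quot_map g"
      using f unfolding quot_map_eq_iff[OF fc gc] by (auto simp: g_def supported_on_off)
    then show "y \<in> quot_map ` supported_on ?X" using g y by blast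
  next
    fix y assume "y \<in> quot_map ` supported_on ?X"
    then show "y \<in> quot_map ` supported_on B" by (auto simp: supported_on_def)
  qed
  interpret P: ring PA by (rule ring_path_algebra)
  let ?W = "quot_map ` supported_on B"
  have "VectorSpace.subspace K ?W A"
    unfolding VectorSpace.subspace_def
  proof (intro conjI LinearCombinations.submodule.intro)
    show "vectorspace K A" "Module.module K A" by unfold_locales
    show W: "?W \<subseteq> carrier A"
      using quot_map_closed by (auto simp: supported_on_def)
    show "v \<oplus>\<^bsub>A\<^esub> w \<in> ?W" if vw: "v \<in> ?W" "w \<in> ?W" for v w
    proof -
      obtain f g where f: "f \<in> supported_on B" "v = quot_map f" and g: "g \<in> supported_on B" "w = quot_map g"
        using vw by blast
      then have "f \<oplus>\<^bsub>PA\<^esub> g \<in> supported_on B"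
        using P.a_closed[of f g] by (auto simp: supported_on_def path_algebra_ops)
      moreover have "v \<oplus>\<^bsub>A\<^esub> w = quot_map (f \<oplus>\<^bsub>PA\<^esub> g)"
        using f g quot_map_add by (simp add: supported_on_def)
      ultimately show ?thesis by blast
    qed
    show smult: "c \<odot>\<^bsub>A\<^esub> v \<in> ?W" if cv: "c \<in> carrier K" "v \<in> ?W" for c v
    proof -
      obtain f where f: "f \<in> supported_on B" "v = quot_map f"
        using cv by blast
      then have "c \<odot>\<^bsub>PA\<^esub> f \<in> supported_on B"
        using path_algebra_smult_closed[OF cv(1), of f] cv(1) by (auto simp: supported_on_def path_algebra_ops)
      moreover have "c \<odot>\<^bsub>A\<^esub> v = quot_map (c \<odot>\<^bsub>PA\<^esub> f)"
        using f cv quot_map_smult by (simp add: supported_on_def)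
      ultimately show ?thesis by blast
    qed
    have z: "\<zero>\<^bsub>PA\<^esub> \<in> supported_on B"
      using P.zero_closed by (simp add: supported_on_def path_algebra_ops)
    then have "quot_map \<zero>\<^bsub>PA\<^esub> \<in> ?W" by blast
    then show "\<zero>\<^bsub>A\<^esub> \<in> ?W"
      using smult[OF zero_closed] W A.lmult_0 by (metis subsetD)
  qed
  then interpret W: vectorspace K "A\<lparr>carrier := ?W\<rparr>"
    by (rule A.subspace_is_vs)
  have X: "?X \<subseteq> nonzero_paths" by blast
  show ?thesis
  proof (rule W.dim_eq_card_coords[OF fin])
    show "quot_map f \<in> carrier (A\<lparr>carrier := ?W\<rparr>)" if "f \<in> coord_funs K ?X" for f
      using that image by auto
    show "quot_map ` coord_funs K ?X = carrier (A\<lparr>carrier := ?W\<rparr>)"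
      using image by simp
  qed (use quot_map_coords[OF fin X] in simp_all)
qed

lemma vertex_mult:
  assumes a: "a \<in> verts Q"
  shows "f \<in> carrier PA \<Longrightarrow> quot_map (path_element K (a, [], a)) \<otimes>\<^bsub>A\<^esub> quot_map f
      = quot_map (\<lambda>r. if fst r = a then f r else \<zero>)"
    and "f \<in> carrier PA \<Longrightarrow> quot_map f \<otimes>\<^bsub>A\<^esub> quot_map (path_element K (a, [], a))
      = quot_map (\<lambda>r. if snd (snd r) = a then f r else \<zero>)"
proof -
  let ?e = "path_element K (a, [], a)"
  have e: "?e \<in> carrier PA"
    using a by (intro path_element_closed) (simp add: awalk_Nil_iff)
  have triv: "?e (u, p, v) = \<zero>" if "p \<noteq> []" for u p v
    using that by (simp add: path_element_def)
  assume f: "f \<in> carrier PA"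
  have "?e \<otimes>\<^bsub>PA\<^esub> f = (\<lambda>r. if fst r = a then f r else \<zero>)"
  proof
    show "(?e \<otimes>\<^bsub>PA\<^esub> f) r = (if fst r = a then f r else \<zero>)" for r
      using trivial_mult_left[OF f e triv, of "fst r" "fst (snd r)" "snd (snd r)"] f
      by (auto simp: path_element_def)
  qed
  then show "quot_map ?e \<otimes>\<^bsub>A\<^esub> quot_map f = quot_map (\<lambda>r. if fst r = a then f r else \<zero>)"
    using quot_map_mult[OF e f] by simp
  have "f \<otimes>\<^bsub>PA\<^esub> ?e = (\<lambda>r. if snd (snd r) = a then f r else \<zero>)"
  proof
    show "(f \<otimes>\<^bsub>PA\<^esub> ?e) r = (if snd (snd r) = a then f r else \<zero>)" for r
      using trivial_mult_right[OF f e triv, of "fst r" "fst (snd r)" "snd (snd r)"] f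
      by (auto simp: path_element_def)
  qed
  then show "quot_map f \<otimes>\<^bsub>A\<^esub> quot_map ?e = quot_map (\<lambda>r. if snd (snd r) = a then f r else \<zero>)"
    using quot_map_mult[OF f e] by simp
qed

lemma restrict_supported_on:
  assumes "f \<in> carrier PA"
  shows "(\<lambda>r. if P r then f r else \<zero>) \<in> supported_on (Collect P)"
proof -
  have "{r. (if P r then f r else \<zero>) \<noteq> \<zero>} \<subseteq> {r. f r \<noteq> \<zero>}" by auto
  then have "finite {r. (if P r then f r else \<zero>) \<noteq> \<zero>}"
    by (rule finite_subset) (rule path_algebra_finite_support[OF assms])
  then have "(\<lambda>r. if P r then f r else \<zero>) \<in> carrier PA"
    using assms by (intro path_algebra_memI) (auto simp: path_algebra_off_paths)
  then show ?thesis by (simp add: supported_on_def)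
qed

lemma restrict_id:
  assumes "f \<in> supported_on (Collect P)"
  shows "(\<lambda>r. if P r then f r else \<zero>) = f"
  using assms by (intro ext) (simp add: supported_on_off)

context
  fixes e :: "'v \<Rightarrow> 'a"
  assumes e: "\<And>a. a \<in> verts Q \<Longrightarrow> e a = quot_map (path_element K (a, [], a))"
begin

lemma proj_module_eq:
  assumes a: "a \<in> verts Q"
  shows "{e a \<otimes>\<^bsub>A\<^esub> x | x. x \<in> carrier A} = quot_map ` supported_on {r. fst r = a}"
proof (intro equalityI subsetI)
  fix y assume "y \<in> {e a \<otimes>\<^bsub>A\<^esub> x | x. x \<in> carrier A}"
  then obtain x where "x \<in> carrier A" and y: "y = e a \<otimes>\<^bsub>A\<^esub> x" by blast
  then obtain f where "f \<in> carrier PA" "x = quot_map f"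
    by (auto simp: quot_map_surj[symmetric])
  then show "y \<in> quot_map ` supported_on {r. fst r = a}"
    using vertex_mult(1)[OF a] restrict_supported_on e[OF a] unfolding y by simp
next
  fix y assume "y \<in> quot_map ` supported_on {r. fst r = a}"
  then obtain f where f: "f \<in> supported_on {r. fst r = a}" "y = quot_map f" by blast
  then have "f \<in> carrier PA" by (simp add: supported_on_def)
  then have "y = e a \<otimes>\<^bsub>A\<^esub> quot_map f" "quot_map f \<in> carrier A"
    using vertex_mult(1)[OF a] f restrict_id[OF f(1)] e[OF a] quot_map_closed by auto
  then show "y \<in> {e a \<otimes>\<^bsub>A\<^esub> x | x. x \<in> carrier A}" by blast
qed

lemma corner_eq:
  assumes a: "a \<in> verts Q" and b: "b \<in> verts Q"
  shows "{e a \<otimes>\<^bsub>A\<^esub> x \<otimes>\<^bsub>A\<^esub> e b | x. x \<in> carrier A}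
    = quot_map ` supported_on {r. fst r = a \<and> snd (snd r) = b}"
proof -
  have mult: "e a \<otimes>\<^bsub>A\<^esub> quot_map f \<otimes>\<^bsub>A\<^esub> e b
      = quot_map (\<lambda>r. if fst r = a \<and> snd (snd r) = b then f r else \<zero>)"
    if f: "f \<in> carrier PA" for f
  proof -
    have "(\<lambda>r. if fst r = a then f r else \<zero>) \<in> carrier PA"
      using restrict_supported_on[OF f, of "\<lambda>r. fst r = a"] by (simp add: supported_on_def)
    then have "e a \<otimes>\<^bsub>A\<^esub> quot_map f \<otimes>\<^bsub>A\<^esub> e b
        = quot_map (\<lambda>r. if snd (snd r) = b then if fst r = a then f r else \<zero> else \<zero>)"
      using vertex_mult(1)[OF a f] vertex_mult(2)[OF b] e[OF a] e[OF b] by simp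
    also have "(\<lambda>r. if snd (snd r) = b then if fst r = a then f r else \<zero> else \<zero>)
        = (\<lambda>r. if fst r = a \<and> snd (snd r) = b then f r else \<zero>)"
      by auto
    finally show ?thesis .
  qed
  show ?thesis
  proof (intro equalityI subsetI)
    fix y assume "y \<in> {e a \<otimes>\<^bsub>A\<^esub> x \<otimes>\<^bsub>A\<^esub> e b | x. x \<in> carrier A}"
    then obtain x where "x \<in> carrier A" and y: "y = e a \<otimes>\<^bsub>A\<^esub> x \<otimes>\<^bsub>A\<^esub> e b" by blast
    then obtain f where "f \<in> carrier PA" "x = quot_map f"
      by (auto simp: quot_map_surj[symmetric])
    then show "y \<in> quot_map ` supported_on {r. fst r = a \<and> snd (snd r) = b}"
      using mult restrict_supported_on unfolding y by simp
  next
    fix y assume "y \<in> quot_map ` supported_on {r. fst r = a \<and> snd (snd r) = b}"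
    then obtain f where f: "f \<in> supported_on {r. fst r = a \<and> snd (snd r) = b}" "y = quot_map f"
      by blast
    then have "f \<in> carrier PA" by (simp add: supported_on_def)
    then have "y = e a \<otimes>\<^bsub>A\<^esub> quot_map f \<otimes>\<^bsub>A\<^esub> e b" "quot_map f \<in> carrier A"
      using mult f restrict_id[OF f(1)] quot_map_closed by auto
    then show "y \<in> {e a \<otimes>\<^bsub>A\<^esub> x \<otimes>\<^bsub>A\<^esub> e b | x. x \<in> carrier A}" by blast
  qed
qed

end

end

section \<open>Path lengths in a Nakayama algebra, from a given source and into a given
  target\<close>

section \<open>Nakayama algebras\<close>

lemma wf_cyclic_quiver: "wf_digraph (cyclic_quiver n)"
  by unfold_locales (auto simp: cyclic_quiver_def cyc_succ_def)

text \<open>An arrow has the name of its source, so the arrow list is also the list of vertices left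
  along the way.\<close>

definition cyc_path :: "nat \<Rightarrow> nat \<Rightarrow> nat \<Rightarrow> (nat, nat) path" where
  "cyc_path n a m = (a, map (\<lambda>i. (cyc_succ n ^^ i) a) [0..<m], (cyc_succ n ^^ m) a)"

lemma cyc_path_simps [simp]:
  "fst (cyc_path n a m) = a" "snd (snd (cyc_path n a m)) = (cyc_succ n ^^ m) a"
  "length (fst (snd (cyc_path n a m))) = m"
  by (simp_all add: cyc_path_def)

lemma inj_cyc_path: "inj (cyc_path n a)"
  by (metis cyc_path_simps(3) injI)

text \<open>Every vertex has a single outgoing arrow, so source and length determine the
  path.\<close>

lemma cyclic_awalk_iff:
  "pre_digraph.awalk (cyclic_quiver n) a p b \<longleftrightarrow> a \<in> {1..n} \<and> (a, p, b) = cyc_path n a (length p)"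
proof -
  have cas: "pre_digraph.cas (cyclic_quiver n) a p b \<longleftrightarrow> (a, p, b) = cyc_path n a (length p)" for a
  proof (induction p arbitrary: a)
    case Nil
    then show ?case by (auto simp: pre_digraph.cas.simps cyc_path_def)
  next
    case (Cons x p)
    have "map (\<lambda>i. (cyc_succ n ^^ i) a) [0..<length (x # p)]
        = a # map (\<lambda>i. (cyc_succ n ^^ i) (cyc_succ n a)) [0..<length p]"
      by (simp add: upt_conv_Cons map_Suc_upt[symmetric] funpow_swap1 o_def del: upt_Suc)
    then show ?case
      using Cons.IH by (auto simp: pre_digraph.cas.simps cyclic_quiver_def cyc_path_def funpow_swap1)
  qed
  have "set p \<subseteq> {1..n}" if "a \<in> {1..n}" "(a, p, b) = cyc_path n a (length p)"
  proof -
    have "set p = (\<lambda>i. (cyc_succ n ^^ i) a) ` {0..<length p}"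
      using that(2) by (metis Pair_inject cyc_path_def list.set_map set_upt)
    then show ?thesis using cyc_succ_pow_in[OF that(1)] by auto
  qed
  then show ?thesis
    unfolding pre_digraph.awalk_def cas by (auto simp: cyclic_quiver_def)
qed

text \<open>Closure is phrased with \<open>m + k\<close> to match the cutting of a path of length
  \<open>m + k\<close> in two; it is applied to the lengths from a source and to those into a
  target.\<close>

lemma downward_closed_eq_lessThan:
  fixes S :: "nat set"
  assumes "finite S" and down: "\<And>m k. m + k \<in> S \<Longrightarrow> m \<in> S"
  shows "S = {..<card S}"
proof -
  have "m < card S" if "m \<in> S" for m
  proof -
    have "{..m} \<subseteq> S"
    proof
      fix i assume "i \<in> {..m}"
      then have "i + (m - i) \<in> S" using that by simp
      then show "i \<in> S" by (rule down)
    qed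
    from card_mono[OF assms(1) this] show ?thesis by simp
  qed
  moreover have "card S \<le> m" if "m \<notin> S" for m
  proof -
    have "S \<subseteq> {..<m}"
    proof
      fix i assume "i \<in> S"
      then have "\<not> m \<le> i" using that down[of m "i - m"] by auto
      then show "i \<in> {..<m}" by simp
    qed
    from card_mono[OF _ this] show ?thesis by simp
  qed
  ultimately show ?thesis by (metis (no_types, lifting) ext Orderings.order_class.leD lessThan_iff subsetI subset_antisym)
qed

text \<open>Both sides say that \<open>m\<close> is congruent to \<open>b - a\<close> modulo
  \<open>n\<close>: reflection negates differences, and exchanging source and target negates them
  once more.\<close>

lemma cyc_succ_pow_reflect:
  assumes "a \<in> {1..n}" "b \<in> {1..n}"
  shows "(cyc_succ n ^^ m) a = b \<longleftrightarrow> (cyc_succ n ^^ m) (n + 1 - b) = n + 1 - a"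
proof -
  have ab: "n + 1 - a \<in> {1..n}" "n + 1 - b \<in> {1..n}" using assms by auto
  have "(cyc_succ n ^^ m) a = b \<longleftrightarrow> (a - 1 + m) mod n = b - 1"
    using assms unfolding cyc_succ_pow[OF assms(1)] by auto
  also have "\<dots> \<longleftrightarrow> m mod n = (if a - 1 \<le> b - 1 then b - 1 - (a - 1) else b - 1 + n - (a - 1))"
    by (rule add_mod_eq_iff) (use assms in auto)
  also have "(if a - 1 \<le> b - 1 then b - 1 - (a - 1) else b - 1 + n - (a - 1))
      = (if n - b \<le> n - a then n - a - (n - b) else n - a + n - (n - b))"
    using assms by auto
  also have "m mod n = \<dots> \<longleftrightarrow> (n - b + m) mod n = n - a"
    by (rule add_mod_eq_iff[symmetric]) (use assms in auto)
  also have "\<dots> \<longleftrightarrow> (cyc_succ n ^^ m) (n + 1 - b) = n + 1 - a"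
    using assms unfolding cyc_succ_pow[OF ab(2)] by auto
  finally show ?thesis .
qed

context nakayama_algebra
begin

sublocale Q: monomial_quotient K "cyclic_quiver n" A Z \<phi>
proof (intro monomial_quotient.intro quiver_over_field.intro monomial_quotient_axioms.intro
    quiver_over_field_axioms.intro wf_cyclic_quiver)
  show "field K" "assoc_algebra K A" by unfold_locales
  show "finite (verts (cyclic_quiver n))" by (simp add: cyclic_quiver_def)
  show "Z \<subseteq> quiver_paths (cyclic_quiver n)"
    using relations_nontrivial by (auto simp: nontrivial_paths_def)
qed (rule presentation)

abbreviation e :: "nat \<Rightarrow> 'a" where
  "e \<equiv> vertex_idempotent K n Z \<phi>"

definition nonzero_length :: "nat \<Rightarrow> nat \<Rightarrow> bool" where
  "nonzero_length a m \<longleftrightarrow> cyc_path n a m \<in> Q.nonzero_paths"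

lemma awalk_cyc_path:
  assumes "a \<in> {1..n}"
  shows "Q.awalk a (fst (snd (cyc_path n a m))) ((cyc_succ n ^^ m) a)"
  unfolding cyclic_awalk_iff using assms by (simp add: cyc_path_def)

lemma nonzero_length_iff:
  assumes "a \<in> {1..n}"
  shows "nonzero_length a m \<longleftrightarrow> cyc_path n a m \<notin> path_multiples (cyclic_quiver n) Z"
proof -
  have "cyc_path n a m \<in> quiver_paths (cyclic_quiver n)"
    using awalk_cyc_path[OF assms, of m] by (cases "cyc_path n a m") (auto simp: cyc_path_def)
  then show ?thesis by (simp add: nonzero_length_def Q.nonzero_paths_def)
qed

lemma cyc_path_append:
  "cyc_path n a (j + k) = (a, fst (snd (cyc_path n a j)) @ fst (snd (cyc_path n ((cyc_succ n ^^ j) a) k)),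
     (cyc_succ n ^^ (j + k)) a)"
proof -
  have "map (\<lambda>i. (cyc_succ n ^^ i) a) [j..<j + k]
      = map (\<lambda>i. (cyc_succ n ^^ i) ((cyc_succ n ^^ j) a)) [0..<k]"
    by (rule nth_equalityI) (simp_all add: add.commute funpow_add)
  then show ?thesis
    by (simp add: cyc_path_def upt_add_eq_append[of 0 j k])
qed

text \<open>If the prefix were a multiple of a relation, extending it to the right would make the
  whole path one too.\<close>

lemma nonzero_length_prefix:
  assumes a: "a \<in> {1..n}" and nz: "nonzero_length a (j + k)"
  shows "nonzero_length a j"
proof (rule ccontr)
  assume "\<not> ?thesis"
  then have "(a, fst (snd (cyc_path n a j)), (cyc_succ n ^^ j) a) \<in> path_multiples (cyclic_quiver n) Z"
    unfolding nonzero_length_iff[OF a] by (simp add: cyc_path_def)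
  from Q.path_multiples_append_right[OF this awalk_cyc_path[of _ k]]
  show False
    using nz cyc_succ_pow_in[OF a] unfolding nonzero_length_iff[OF a] cyc_path_append
    by (simp add: add.commute[of j] funpow_add)
qed

lemma nonzero_length_suffix:
  assumes a: "a \<in> {1..n}" and nz: "nonzero_length a (j + k)"
  shows "nonzero_length ((cyc_succ n ^^ j) a) k"
proof (rule ccontr)
  let ?b = "(cyc_succ n ^^ j) a"
  have b: "?b \<in> {1..n}" by (rule cyc_succ_pow_in[OF a])
  assume "\<not> ?thesis"
  then have "(?b, fst (snd (cyc_path n ?b k)), (cyc_succ n ^^ k) ?b) \<in> path_multiples (cyclic_quiver n) Z"
    unfolding nonzero_length_iff[OF b] by (simp add: cyc_path_def)
  from Q.path_multiples_append_left[OF awalk_cyc_path[OF a] this]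
  show False
    using nz unfolding nonzero_length_iff[OF a] cyc_path_append
    by (simp add: add.commute[of j] funpow_add)
qed

text \<open>A multiple of a nontrivial path is nontrivial. This makes the dimensions on both sides
  positive, and with them the weight.\<close>

lemma nonzero_length_0:
  assumes a: "a \<in> {1..n}"
  shows "nonzero_length a 0"
proof -
  have "cyc_path n a 0 \<notin> path_multiples (cyclic_quiver n) Z"
    using relations_nontrivial
    by (auto simp: cyc_path_def nontrivial_paths_def elim!: Q.path_multiplesE)
  then show ?thesis by (simp add: nonzero_length_iff[OF a])
qed

lemma nonzero_paths_from:
  assumes "a \<in> {1..n}"
  shows "{r. fst r = a \<and> P (snd (snd r))} \<inter> Q.nonzero_paths
    = cyc_path n a ` {m. nonzero_length a m \<and> P ((cyc_succ n ^^ m) a)}"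
proof (intro equalityI subsetI)
  fix r assume r: "r \<in> {r. fst r = a \<and> P (snd (snd r))} \<inter> Q.nonzero_paths"
  obtain u p v where uv: "r = (u, p, v)" by (cases r)
  have "Q.awalk u p v" using r by (auto simp: uv Q.nonzero_paths_def)
  moreover have "u = a" using r by (simp add: uv)
  ultimately have "r = cyc_path n a (length p)"
    unfolding cyclic_awalk_iff uv by blast
  then show "r \<in> cyc_path n a ` {m. nonzero_length a m \<and> P ((cyc_succ n ^^ m) a)}"
    using r by (auto simp: nonzero_length_def)
qed (auto simp: nonzero_length_def)

lemma finite_nonzero_length:
  assumes a: "a \<in> {1..n}"
  shows "finite {m. nonzero_length a m}"
proof (rule finite_imageD)
  show "finite (cyc_path n a ` {m. nonzero_length a m})"
    by (rule finite_subset[OF _ Q.finite_nonzero_paths[OF finite_dimensional]])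
      (auto simp: nonzero_length_def)
qed (rule inj_on_subset[OF inj_cyc_path], simp)

lemma vertex_idempotent_eq: "e a = Q.quot_map (path_element K (a, [], a))"
  by (simp add: vertex_idempotent_def Q.quot_map_def)

lemma proj_dim_eq:
  assumes a: "a \<in> {1..n}"
  shows "proj_dim K A e a = card {m. nonzero_length a m}"
proof -
  have v: "a \<in> verts (cyclic_quiver n)" using a by (simp add: cyclic_quiver_def)
  have "proj_module A e a = Q.quot_map ` Q.supported_on {r. fst r = a}"
    unfolding proj_module_def by (rule Q.proj_module_eq[OF vertex_idempotent_eq v])
  then have "proj_dim K A e a = card ({r. fst r = a} \<inter> Q.nonzero_paths)"
    unfolding proj_dim_def
    using Q.dim_quot_map_image Q.finite_nonzero_paths[OF finite_dimensional] by simp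
  also have "\<dots> = card {m. nonzero_length a m}"
    using nonzero_paths_from[OF a, of "\<lambda>_. True"]
    by (simp add: card_image inj_on_subset[OF inj_cyc_path])
  finally show ?thesis .
qed

lemma corner_dim_eq:
  assumes a: "a \<in> {1..n}" and b: "b \<in> {1..n}"
  shows "vectorspace.dim K (A\<lparr>carrier := corner A e a b\<rparr>)
    = card {m. nonzero_length a m \<and> (cyc_succ n ^^ m) a = b}"
proof -
  have v: "a \<in> verts (cyclic_quiver n)" "b \<in> verts (cyclic_quiver n)"
    using a b by (simp_all add: cyclic_quiver_def)
  have "corner A e a b = Q.quot_map ` Q.supported_on {r. fst r = a \<and> snd (snd r) = b}"
    unfolding corner_def by (rule Q.corner_eq[OF vertex_idempotent_eq v])
  then have "vectorspace.dim K (A\<lparr>carrier := corner A e a b\<rparr>)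
      = card ({r. fst r = a \<and> snd (snd r) = b} \<inter> Q.nonzero_paths)"
    using Q.dim_quot_map_image Q.finite_nonzero_paths[OF finite_dimensional] by simp
  also have "\<dots> = card {m. nonzero_length a m \<and> (cyc_succ n ^^ m) a = b}"
    using nonzero_paths_from[OF a, of "\<lambda>v. v = b"]
    by (simp add: card_image inj_on_subset[OF inj_cyc_path])
  finally show ?thesis .
qed

text \<open>Closure under prefixes and finiteness make the nonzero lengths from \<open>a\<close> an
  initial segment, whose size is the dimension of the projective at \<open>a\<close>.\<close>

lemma nonzero_length_less_iff:
  assumes a: "a \<in> {1..n}"
  shows "nonzero_length a m \<longleftrightarrow> m < proj_dim K A e a"
proof -
  have "{m. nonzero_length a m} = {..<card {m. nonzero_length a m}}"
    by (rule downward_closed_eq_lessThan)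
      (use finite_nonzero_length[OF a] nonzero_length_prefix[OF a] in auto)
  then show ?thesis
    unfolding proj_dim_eq[OF a] by blast
qed

text \<open>The nonzero path of length \<open>m\<close> ending at \<open>b\<close>, if any, starts at \<open>start_of b m\<close>.\<close>

definition start_of :: "nat \<Rightarrow> nat \<Rightarrow> nat" where
  "start_of b m = n + 1 - (cyc_succ n ^^ m) (n + 1 - b)"

text \<open>This is the dimension of the left projective of \<open>A\<close> at \<open>b\<close>,
  counted by the lengths of the nonzero paths ending there.\<close>

definition coproj_dim :: "nat \<Rightarrow> nat" where
  "coproj_dim b = card {m. nonzero_length (start_of b m) m}"

lemma start_of_in:
  assumes "b \<in> {1..n}"
  shows "start_of b m \<in> {1..n}"
proof -
  have "n + 1 - b \<in> {1..n}" using assms by auto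
  from cyc_succ_pow_in[OF this, of m] show ?thesis by (auto simp: start_of_def)
qed

lemma start_of_eq_iff:
  assumes "a \<in> {1..n}" "b \<in> {1..n}"
  shows "start_of b m = a \<longleftrightarrow> (cyc_succ n ^^ m) (n + 1 - b) = n + 1 - a"
proof -
  have "n + 1 - b \<in> {1..n}" using assms by auto
  from cyc_succ_pow_in[OF this, of m] show ?thesis using assms by (auto simp: start_of_def)
qed

text \<open>Dropping the first \<open>k\<close> arrows of the path of length \<open>m + k\<close>
  ending at \<open>b\<close> leaves the path of length \<open>m\<close> ending at
  \<open>b\<close>.\<close>

lemma cyc_succ_pow_start_of:
  assumes b: "b \<in> {1..n}"
  shows "(cyc_succ n ^^ k) (start_of b (m + k)) = start_of b m"
proof -
  have r: "n + 1 - start_of b m = (cyc_succ n ^^ m) (n + 1 - b)" for m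
    using start_of_eq_iff[OF start_of_in[OF b] b] by metis
  show ?thesis
    unfolding cyc_succ_pow_reflect[OF start_of_in[OF b] start_of_in[OF b]] r
    by (simp add: add.commute[of m] funpow_add)
qed

lemma nonzero_length_less_coproj_dim:
  assumes b: "b \<in> {1..n}"
  shows "nonzero_length (start_of b m) m \<longleftrightarrow> m < coproj_dim b"
proof -
  let ?D = "{m. nonzero_length (start_of b m) m}"
  have "?D = {..<card ?D}"
  proof (rule downward_closed_eq_lessThan)
    \<comment> \<open>The source varies with \<open>m\<close>, but it is one of finitely many
      vertices, each with finitely many nonzero lengths.\<close>
    have "?D \<subseteq> (\<Union>a\<in>{1..n}. {m. nonzero_length a m})"
      using start_of_in[OF b] by blast
    then show "finite ?D"
      by (rule finite_subset) (use finite_nonzero_length in blast)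
    show "m \<in> ?D" if "m + k \<in> ?D" for m k
    proof -
      have "nonzero_length (start_of b (m + k)) (k + m)"
        using that by (simp add: add.commute)
      from nonzero_length_suffix[OF start_of_in[OF b] this] show ?thesis
        by (simp add: cyc_succ_pow_start_of[OF b])
    qed
  qed
  then show ?thesis
    unfolding coproj_dim_def by blast
qed

lemma cartan_magnitude:
  defines "C \<equiv> map_mat rat_of_nat (cartan_matrix K A n e)" and "p \<equiv> proj_dim K A e"
  shows "has_magnitude C"
    and "pre_digraph.cycle (resolution_quiver n p) I \<Longrightarrow>
      magnitude C = rat_of_nat (cycle_periodicity I) / cycle_weight n p I"
proof -
  define c where "c a b = card {m. nonzero_length a m \<and> (cyc_succ n ^^ m) a = b}" for a b
  have C: "C = mat n n (\<lambda>(i, j). rat_of_nat (c (j + 1) (i + 1)))"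
  proof (rule eq_matI)
    fix i j assume "i < dim_row (mat n n (\<lambda>(i, j). rat_of_nat (c (j + 1) (i + 1))))"
      "j < dim_col (mat n n (\<lambda>(i, j). rat_of_nat (c (j + 1) (i + 1))))"
    then have "i < n" "j < n" by simp_all
    then show "C $$ (i, j) = mat n n (\<lambda>(i, j). rat_of_nat (c (j + 1) (i + 1))) $$ (i, j)"
      using corner_dim_eq[of "j + 1" "i + 1"] by (simp add: C_def cartan_matrix_def c_def)
  qed (simp_all add: C_def cartan_matrix_def)
  have p_pos: "p a > 0" if "a \<in> {1..n}" for a
    using nonzero_length_less_iff[OF that, of 0] nonzero_length_0[OF that] by (simp add: p_def)
  have q_pos: "coproj_dim b > 0" if "b \<in> {1..n}" for b
    using nonzero_length_less_coproj_dim[OF that, of 0] nonzero_length_0[OF start_of_in[OF that]] by simp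
  have cp: "c a b = card {m. m < p a \<and> (cyc_succ n ^^ m) a = b}" if "a \<in> {1..n}" "b \<in> {1..n}" for a b
    by (simp add: c_def p_def nonzero_length_less_iff[OF that(1)])
  have cq: "c a b = card {m. m < coproj_dim b \<and> (cyc_succ n ^^ m) (n + 1 - b) = n + 1 - a}"
    if ab: "a \<in> {1..n}" "b \<in> {1..n}" for a b
  proof -
    \<comment> \<open>The same path is described by its source on the left and by its target on the
      right.\<close>
    have "nonzero_length a m \<and> (cyc_succ n ^^ m) a = b \<longleftrightarrow>
        m < coproj_dim b \<and> (cyc_succ n ^^ m) (n + 1 - b) = n + 1 - a" for m
      unfolding cyc_succ_pow_reflect[OF ab] start_of_eq_iff[OF ab, symmetric]
        nonzero_length_less_coproj_dim[OF ab(2), symmetric] by auto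
    then show ?thesis by (simp add: c_def)
  qed
  show "has_magnitude C"
    by (rule cyclic_cartan_magnitude(1)[OF order_pos C p_pos q_pos cp cq])
  show "magnitude C = rat_of_nat (cycle_periodicity I) / cycle_weight n p I"
    if "pre_digraph.cycle (resolution_quiver n p) I"
    by (rule cyclic_cartan_magnitude(2)[OF order_pos C p_pos q_pos cp cq that])
qed

end

theorem theorem2p2:
  fixes K :: "('k, 'm) ring_scheme"
    and A :: "('k, 'a, 'z) module_scheme"
    and n :: nat
    and Z :: "(nat, nat) path set"
    and \<phi> :: "((nat, nat) path \<Rightarrow> 'k) set \<Rightarrow> 'a"
    and e :: "nat \<Rightarrow> 'a"
    and C :: "rat mat"
    and p :: "nat \<Rightarrow> nat"
  assumes "nakayama_algebra K A n Z \<phi>"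
    and "e = vertex_idempotent K n Z \<phi>"
    and "C = map_mat rat_of_nat (cartan_matrix K A n e)"
    and "p = proj_dim K A e"
  shows "has_magnitude C \<and>
    (\<forall>I. pre_digraph.cycle (resolution_quiver n p) I \<longrightarrow>
         magnitude C = rat_of_nat (cycle_periodicity I) / cycle_weight n p I)"
  using nakayama_algebra.cartan_magnitude[OF assms(1)] unfolding assms(2-4) by blast

end
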